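(* Let $G$ be a finite connected graph (multiple edges allowed, no loops) that is not a regular bipartite graph. Let $w \in V(G)$ and $\lambda \in \{0,1\}$. Then $G$ has a spanning weakly even $(w,\lambda)$-tree. In particular, every connected graph that is not regular bipartite has a spanning tree in which all leaves of maximum degree in $G$ lie in the same part of the tree's bipartition, and every regular nonbipartite connected graph has a spanning tree all of whose leaves lie in the same part of the tree's bipartition.
   Context: Graphs are finite, may have multiple edges, but no loops. $\Delta(G)$ denotes the maximum degree of $G$. Given an ordered bipartition $(X,Y)$ of a bipartite graph $H$, a vertex of $H$ is type-$0$ if it lies in $X$ and type-$1$ if it lies in $Y$. For $w \in V(H)$ and $\lambda \in \{0,1\}$, the $(w,\lambda)$-bipartition of a connected bipartite graph $H$ is the ordered bipartition of $H$ in which $w$ has type $\lambda$; a $(w,\lambda)$-tree is a tree equipped with its $(w,\lambda)$-bipartition. A tree $T \subseteq G$ with ordered bipartition $(X,Y)$ is weakly even (in $G$) if every leaf of $T$ that has degree $\Delta(G)$ in $G$ is type-$0$ (i.e. lies in $X$). *)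

theory Defs
  imports Main
begin

text \<open>
  Undirected multigraphs, given by a vertex set, an edge set and a map sending each edge to the
  set of its ends.  Parallel edges are distinct edges with the same ends.  (The trees of the
  entry Graph_Theory do not fit here: in a symmetric digraph an edge traversed back and
  forth counts as a cycle.)
\<close>

record ('a, 'b) multigraph =
  verts :: "'a set"
  edges :: "'b set"
  ends  :: "'b \<Rightarrow> 'a set"

locale finite_loopless_multigraph =
  fixes G :: "('a, 'b) multigraph"
  assumes finite_verts: "finite (verts G)"
    and finite_edges: "finite (edges G)"
    and ends_in_verts: "e \<in> edges G \<Longrightarrow> ends G e \<subseteq> verts G"
    and two_ends: "e \<in> edges G \<Longrightarrow> card (ends G e) = 2"

text \<open>Counting incident edges is the usual degree only because there are no loops.\<close>

definition vdegree :: "('a, 'b) multigraph \<Rightarrow> 'a \<Rightarrow> nat" where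
  "vdegree G v = card {e \<in> edges G. v \<in> ends G e}"

definition max_degree :: "('a, 'b) multigraph \<Rightarrow> nat" where
  "max_degree G = Max (vdegree G ` verts G)"

definition regular_graph :: "('a, 'b) multigraph \<Rightarrow> bool" where
  "regular_graph G \<longleftrightarrow> (\<exists>k. \<forall>v \<in> verts G. vdegree G v = k)"

text \<open>A walk is recorded by its vertices \<open>vs\<close> and its edges \<open>es\<close>, where
  \<open>es ! i\<close> joins \<open>vs ! i\<close> to \<open>vs ! Suc i\<close>.\<close>

definition walk :: "('a, 'b) multigraph \<Rightarrow> 'a list \<Rightarrow> 'b list \<Rightarrow> bool" where
  "walk G vs es \<longleftrightarrow>
     length vs = Suc (length es) \<and> set vs \<subseteq> verts G \<and> set es \<subseteq> edges G \<and>
     (\<forall>i < length es. ends G (es ! i) = {vs ! i, vs ! Suc i})"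

definition graph_connected :: "('a, 'b) multigraph \<Rightarrow> bool" where
  "graph_connected G \<longleftrightarrow> verts G \<noteq> {} \<and>
     (\<forall>u \<in> verts G. \<forall>v \<in> verts G. \<exists>vs es. walk G vs es \<and> hd vs = u \<and> last vs = v)"

text \<open>The edges of a cycle are required to be distinct, so that traversing one edge back and
  forth is not a cycle, whereas two parallel edges form a cycle of length 2.\<close>

definition is_cycle :: "('a, 'b) multigraph \<Rightarrow> 'a list \<Rightarrow> 'b list \<Rightarrow> bool" where
  "is_cycle G vs es \<longleftrightarrow>
     walk G vs es \<and> es \<noteq> [] \<and> hd vs = last vs \<and> distinct (tl vs) \<and> distinct es"

definition is_tree :: "('a, 'b) multigraph \<Rightarrow> bool" where
  "is_tree T \<longleftrightarrow>
     finite_loopless_multigraph T \<and> graph_connected T \<and> \<not> (\<exists>vs es. is_cycle T vs es)"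

definition subgraph :: "('a, 'b) multigraph \<Rightarrow> ('a, 'b) multigraph \<Rightarrow> bool" where
  "subgraph H G \<longleftrightarrow> verts H \<subseteq> verts G \<and> edges H \<subseteq> edges G \<and>
     (\<forall>e \<in> edges H. ends H e = ends G e)"

definition spanning_tree :: "('a, 'b) multigraph \<Rightarrow> ('a, 'b) multigraph \<Rightarrow> bool" where
  "spanning_tree T G \<longleftrightarrow> is_tree T \<and> subgraph T G \<and> verts T = verts G"

definition leaves :: "('a, 'b) multigraph \<Rightarrow> 'a set" where
  "leaves T = {v \<in> verts T. vdegree T v = 1}"

text \<open>Ordered bipartitions \<open>(X, Y)\<close>; a part may be empty.\<close>

definition bipartition :: "('a, 'b) multigraph \<Rightarrow> 'a set \<times> 'a set \<Rightarrow> bool" where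
  "bipartition H = (\<lambda>(X, Y). X \<union> Y = verts H \<and> X \<inter> Y = {} \<and>
     (\<forall>e \<in> edges H. \<exists>x \<in> X. \<exists>y \<in> Y. ends H e = {x, y}))"

definition bipartite :: "('a, 'b) multigraph \<Rightarrow> bool" where
  "bipartite H \<longleftrightarrow> (\<exists>P. bipartition H P)"

text \<open>The set of vertices of type \<open>l\<close>, for \<open>l \<in> {0, 1}\<close>.\<close>

definition part :: "'a set \<times> 'a set \<Rightarrow> nat \<Rightarrow> 'a set" where
  "part P l = (if l = 0 then fst P else snd P)"

definition wl_bipartition :: "('a, 'b) multigraph \<Rightarrow> 'a \<Rightarrow> nat \<Rightarrow> 'a set \<times> 'a set \<Rightarrow> bool" where
  "wl_bipartition H w l P \<longleftrightarrow> bipartition H P \<and> w \<in> part P l"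

definition wl_tree :: "('a, 'b) multigraph \<Rightarrow> 'a set \<times> 'a set \<Rightarrow> 'a \<Rightarrow> nat \<Rightarrow> bool" where
  "wl_tree T P w l \<longleftrightarrow> is_tree T \<and> wl_bipartition T w l P"

definition weakly_even ::
    "('a, 'b) multigraph \<Rightarrow> ('a, 'b) multigraph \<Rightarrow> 'a set \<times> 'a set \<Rightarrow> bool" where
  "weakly_even G T P \<longleftrightarrow>
     (\<forall>v \<in> leaves T. vdegree G v = max_degree G \<longrightarrow> v \<in> part P 0)"

text \<open>A connected graph has at most one \<open>(w, l)\<close>-bipartition, which justifies calling it
  \<^emph>\<open>the\<close> \<open>(w, l)\<close>-bipartition.\<close>

lemma bipartition_walk_parity:
  assumes "bipartition H (X, Y)" "walk H vs es" "i \<le> length es"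
  shows "vs ! i \<in> X \<longleftrightarrow> (vs ! 0 \<in> X \<longleftrightarrow> even i)"
  using assms(3)
proof (induction i)
  case 0
  then show ?case by simp
next
  case (Suc i)
  let ?e = "es ! i"
  have "?e \<in> edges H" "ends H ?e = {vs ! i, vs ! Suc i}"
    using assms(2) Suc.prems by (auto simp: walk_def)
  then obtain x y where "x \<in> X" "y \<in> Y" "{vs ! i, vs ! Suc i} = {x, y}"
    using assms(1) unfolding bipartition_def by fastforce
  moreover have "X \<inter> Y = {}"
    using assms(1) by (simp add: bipartition_def)
  ultimately have "vs ! Suc i \<in> X \<longleftrightarrow> vs ! i \<notin> X"
    by (auto simp: doubleton_eq_iff)
  then show ?case
    using Suc by auto
qed

lemma wl_bipartition_unique:
  assumes "graph_connected H" "w \<in> verts H"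
    and "wl_bipartition H w l P" "wl_bipartition H w l Q"
  shows "P = Q"
proof -
  obtain X Y X' Y' where PQ: "P = (X, Y)" "Q = (X', Y')"
    by (metis surj_pair)
  have b: "bipartition H (X, Y)" "bipartition H (X', Y')"
    using assms PQ by (auto simp: wl_bipartition_def)
  have parts: "X \<union> Y = verts H" "X \<inter> Y = {}" "X' \<union> Y' = verts H" "X' \<inter> Y' = {}"
    using b by (simp_all add: bipartition_def)
  have "w \<in> part (X, Y) l" "w \<in> part (X', Y') l"
    using assms(3,4) PQ by (simp_all add: wl_bipartition_def)
  then have w: "w \<in> X \<longleftrightarrow> w \<in> X'"
    using parts by (cases "l = 0") (auto simp: part_def)
  have X: "v \<in> X \<longleftrightarrow> v \<in> X'" if v: "v \<in> verts H" for v
  proof -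
    obtain vs es where vs: "walk H vs es" "hd vs = w" "last vs = v"
      using assms(1,2) v unfolding graph_connected_def by blast
    have len: "length vs = Suc (length es)"
      using vs(1) by (simp add: walk_def)
    then have "vs \<noteq> []"
      by auto
    then have ends: "vs ! 0 = w" "vs ! length es = v"
      using vs(2,3) len by (simp_all add: hd_conv_nth last_conv_nth)
    show ?thesis
      using bipartition_walk_parity[OF b(1) vs(1) order.refl]
        bipartition_walk_parity[OF b(2) vs(1) order.refl] w
      unfolding ends by simp
  qed
  have "X = X'"
    using X parts by blast
  moreover have "Y = Y'"
    using X parts by blast
  ultimately show ?thesis
    using PQ by simp
qed

end

theory Submission
  imports Defs
begin

text \<open>
  Let \<open>D\<close> be the set of vertices of maximum degree.  Counting edges shows that every nonempty
  independent \<open>S \<subseteq> D\<close> has more than \<open>|S|\<close> neighbours, since equality would make the graph regular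
  bipartite.  From this one finds a partition \<open>(X, Y)\<close> of the vertices, separating the ends of a
  prescribed edge \<open>wx\<close> in the prescribed way, such that the bipartite graph between \<open>X\<close> and \<open>Y\<close> is
  connected and every nonempty \<open>S \<subseteq> Y \<inter> D\<close> has more than \<open>|S|\<close> neighbours in \<open>X\<close>.  Indeed, take a
  disjoint pair \<open>(X, Y)\<close> with these properties and \<open>|X \<union> Y|\<close> maximal.  If it misses a vertex, a minimal
  violating set for \<open>Y\<close> enlarged by such a vertex yields, after removal of \<open>w\<close>, an independent
  \<open>R \<subseteq> D\<close> with exactly \<open>|R| + 1\<close> neighbours, one of them \<open>x\<close>; delete \<open>R\<close>, identify its neighbourhood to
  \<open>x\<close>, and use induction.

  Finally, a minimal set of edges between \<open>X\<close> and \<open>Y\<close> that keeps both properties is a spanning tree,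
  and the surplus of neighbours gives each vertex of \<open>Y \<inter> D\<close> degree at least 2 in it.
\<close>

section \<open>Connectivity by cuts\<close>

text \<open>Stated through cuts rather than walks, because a cut carries over directly to a union,
  to a graph less a vertex and to a contraction, where walks would have to be rebuilt.\<close>

definition cut_connected :: "'a set \<Rightarrow> ('a \<Rightarrow> 'a \<Rightarrow> bool) \<Rightarrow> bool" where
  "cut_connected V E \<longleftrightarrow> (\<forall>A \<subseteq> V. A \<noteq> {} \<longrightarrow> A \<noteq> V \<longrightarrow> (\<exists>a \<in> A. \<exists>b \<in> V - A. E a b))"

definition nbrs :: "('a \<Rightarrow> 'a \<Rightarrow> bool) \<Rightarrow> 'a set \<Rightarrow> 'a set" where
  "nbrs E S = {b. \<exists>a \<in> S. E a b}"

definition cross :: "'a set \<Rightarrow> 'a set \<Rightarrow> ('a \<Rightarrow> 'a \<Rightarrow> bool) \<Rightarrow> 'a \<Rightarrow> 'a \<Rightarrow> bool" where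
  "cross X Y E a b \<longleftrightarrow> E a b \<and> (a \<in> X \<and> b \<in> Y \<or> a \<in> Y \<and> b \<in> X)"

lemma cut_connectedD:
  assumes "cut_connected V E" "A \<subseteq> V" "A \<noteq> {}" "A \<noteq> V"
  obtains a b where "a \<in> A" "b \<in> V" "b \<notin> A" "E a b"
  using assms unfolding cut_connected_def by (metis Diff_iff)

lemma cut_connected_mono:
  assumes "cut_connected V E" "\<And>a b. a \<in> V \<Longrightarrow> b \<in> V \<Longrightarrow> E a b \<Longrightarrow> E' a b"
  shows "cut_connected V E'"
  unfolding cut_connected_def
proof (intro allI impI)
  fix A assume A: "A \<subseteq> V" "A \<noteq> {}" "A \<noteq> V"
  then obtain a b where "a \<in> A" "b \<in> V" "b \<notin> A" "E a b"
    using cut_connectedD[OF assms(1)] by metis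
  with A assms(2) show "\<exists>a\<in>A. \<exists>b\<in>V - A. E' a b"
    by blast
qed

text \<open>A cut that splits neither \<open>V\<close> nor \<open>W\<close> takes all or nothing of
  each, and a common vertex forces the same choice on both.\<close>

lemma cut_connected_Un:
  assumes "cut_connected V E" "cut_connected W E" "V \<inter> W \<noteq> {}"
  shows "cut_connected (V \<union> W) E"
  unfolding cut_connected_def
proof (intro allI impI)
  fix A assume A: "A \<subseteq> V \<union> W" "A \<noteq> {}" "A \<noteq> V \<union> W"
  consider "A \<inter> V \<noteq> {}" "A \<inter> V \<noteq> V" | "A \<inter> W \<noteq> {}" "A \<inter> W \<noteq> W"
    using A assms(3) by blast
  then show "\<exists>a\<in>A. \<exists>b\<in>V \<union> W - A. E a b"
  proof cases
    case 1
    with assms(1) show ?thesis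
      using cut_connectedD[of V E "A \<inter> V"] by blast
  next
    case 2
    with assms(2) show ?thesis
      using cut_connectedD[of W E "A \<inter> W"] by blast
  qed
qed

lemma cut_connected_insert:
  assumes "cut_connected V E" "v \<in> V" "E u v" "E v u"
  shows "cut_connected (insert u V) E"
proof -
  have "cut_connected {u, v} E"
    unfolding cut_connected_def
  proof (intro allI impI)
    fix A assume A: "A \<subseteq> {u, v}" "A \<noteq> {}" "A \<noteq> {u, v}"
    then have "A = {u} \<and> u \<noteq> v \<or> A = {v} \<and> u \<noteq> v"
      by blast
    then show "\<exists>a\<in>A. \<exists>b\<in>{u, v} - A. E a b"
      using assms by blast
  qed
  then show ?thesis
    using cut_connected_Un[OF _ assms(1), of "{u, v}"] assms(2) by (simp add: insert_absorb)
qed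

text \<open>If a cut of \<open>V\<close> does not split \<open>K\<close>, put \<open>s\<close> on
  the side of \<open>K\<close>. Some edge crosses this cut of \<open>insert s V\<close>, and it
  avoids \<open>s\<close>, whose neighbours in \<open>V\<close> all lie on that same side.\<close>

lemma cut_connected_remove:
  assumes conn: "cut_connected (insert s V) E" and "s \<notin> V" and "K \<subseteq> V" "cut_connected K E"
    and K: "\<And>v. v \<in> V \<Longrightarrow> E s v \<or> E v s \<Longrightarrow> v \<in> K"
  shows "cut_connected V E"
  unfolding cut_connected_def
proof (intro allI impI)
  fix A assume A: "A \<subseteq> V" "A \<noteq> {}" "A \<noteq> V"
  consider "A \<inter> K \<noteq> {}" "A \<inter> K \<noteq> K" | "A \<inter> K = {}" | "K \<subseteq> A"
    by blast
  then show "\<exists>a\<in>A. \<exists>b\<in>V - A. E a b"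
  proof cases
    case 1
    with assms(4) obtain a b where "a \<in> A \<inter> K" "b \<in> K" "b \<notin> A \<inter> K" "E a b"
      using cut_connectedD[of K E "A \<inter> K"] by blast
    with \<open>K \<subseteq> V\<close> show ?thesis
      by blast
  next
    case 2
    have "A \<subseteq> insert s V" "A \<noteq> insert s V"
      using A \<open>s \<notin> V\<close> by auto
    then obtain a b where ab: "a \<in> A" "b \<in> insert s V" "b \<notin> A" "E a b"
      using cut_connectedD[OF conn] A(2) by metis
    moreover have "b \<noteq> s"
      using K[of a] ab 2 A(1) by blast
    ultimately show ?thesis
      by blast
  next
    case 3
    have "insert s A \<subseteq> insert s V" "insert s A \<noteq> {}" "insert s A \<noteq> insert s V"
      using A \<open>s \<notin> V\<close> by auto
    then obtain a b where ab: "a \<in> insert s A" "b \<in> insert s V" "b \<notin> insert s A" "E a b"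
      using cut_connectedD[OF conn] by metis
    then have "b \<in> V" "b \<notin> A"
      by auto
    moreover have "a \<noteq> s"
      using K[of b] ab 3 by blast
    ultimately show ?thesis
      using ab by blast
  qed
qed

section \<open>Neighbourhoods and surplus\<close>

lemma nbrs_Un: "nbrs E (S \<union> T) = nbrs E S \<union> nbrs E T"
  by (auto simp: nbrs_def)

lemma nbrs_mono: "S \<subseteq> T \<Longrightarrow> nbrs E S \<subseteq> nbrs E T"
  by (auto simp: nbrs_def)

text \<open>A neighbour of \<open>S \<inter> T\<close> is a common neighbour of \<open>S\<close> and
  \<open>T\<close>, though not conversely. This serves to uncross sets of small surplus.\<close>

lemma card_nbrs_submodular:
  assumes "finite X"
  shows "card (nbrs E (S \<inter> T) \<inter> X) + card (nbrs E (S \<union> T) \<inter> X)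
    \<le> card (nbrs E S \<inter> X) + card (nbrs E T \<inter> X)"
proof -
  have "card (nbrs E (S \<inter> T) \<inter> X) \<le> card ((nbrs E S \<inter> X) \<inter> (nbrs E T \<inter> X))"
    using assms by (intro card_mono) (auto simp: nbrs_def)
  moreover have "nbrs E (S \<union> T) \<inter> X = (nbrs E S \<inter> X) \<union> (nbrs E T \<inter> X)"
    by (auto simp: nbrs_def)
  ultimately show ?thesis
    using card_Un_Int[of "nbrs E S \<inter> X" "nbrs E T \<inter> X"] assms by simp
qed

text \<open>Hall's condition with strict inequality, so the empty set has to be excluded.\<close>

definition surplus :: "('a \<Rightarrow> 'a \<Rightarrow> bool) \<Rightarrow> 'a set \<Rightarrow> 'a set \<Rightarrow> bool" where
  "surplus E X Y \<longleftrightarrow> (\<forall>S \<subseteq> Y. S \<noteq> {} \<longrightarrow> card S < card (nbrs E S \<inter> X))"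

lemma surplusD: "surplus E X Y \<Longrightarrow> S \<subseteq> Y \<Longrightarrow> S \<noteq> {} \<Longrightarrow> card S < card (nbrs E S \<inter> X)"
  by (simp add: surplus_def)

lemma surplus_mono:
  assumes "surplus E X Y" "X \<subseteq> X'" "Y' \<subseteq> Y" "finite X'"
  shows "surplus E X' Y'"
  unfolding surplus_def
proof (intro allI impI)
  fix S assume "S \<subseteq> Y'" "S \<noteq> {}"
  then have "card S < card (nbrs E S \<inter> X)"
    using assms by (auto simp: surplus_def)
  also have "\<dots> \<le> card (nbrs E S \<inter> X')"
    using assms by (intro card_mono) auto
  finally show "card S < card (nbrs E S \<inter> X')" .
qed

text \<open>Each component of the bipartite graph between \<open>R\<close> and its neighbourhood has at least one
  more vertex in \<open>X\<close> than in \<open>R\<close>, so a total surplus of one leaves room for only one component.\<close>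

lemma cut_connected_tight:
  assumes "finite R" "finite X" "surplus E X R" "card (nbrs E R \<inter> X) \<le> Suc (card R)"
    and sym: "\<And>a b. E a b \<Longrightarrow> E b a"
  shows "cut_connected (R \<union> (nbrs E R \<inter> X)) (cross X R E)"
  unfolding cut_connected_def
proof (intro allI impI, rule ccontr)
  let ?Z = "nbrs E R \<inter> X"
  fix A assume A: "A \<subseteq> R \<union> ?Z" "A \<noteq> {}" "A \<noteq> R \<union> ?Z"
    and no: "\<not> (\<exists>a\<in>A. \<exists>b\<in>R \<union> ?Z - A. cross X R E a b)"
  then have noc: "\<not> cross X R E a b" if "a \<in> A" "b \<in> R \<union> ?Z" "b \<notin> A" for a b
    using that by blast
  \<comment> \<open>Since no edge of the bipartite graph leaves \<open>A\<close>, the neighbours of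
    \<open>R \<inter> A\<close> lie inside \<open>A\<close> and those of \<open>R - A\<close>
    outside, so the two surpluses add up.\<close>
  have in_A: "nbrs E (R \<inter> A) \<inter> X \<subseteq> A"
  proof
    fix b assume b: "b \<in> nbrs E (R \<inter> A) \<inter> X"
    then obtain a where a: "a \<in> R" "a \<in> A" "E a b"
      unfolding nbrs_def by blast
    then have "b \<in> ?Z" "cross X R E a b"
      using b unfolding nbrs_def cross_def by blast+
    then show "b \<in> A"
      using noc a by blast
  qed
  have out_A: "b \<notin> A" if b: "b \<in> nbrs E (R - A) \<inter> X" for b
  proof
    assume "b \<in> A"
    from b obtain a where a: "a \<in> R" "a \<notin> A" "E a b"
      unfolding nbrs_def by blast
    then have "cross X R E b a"
      using b sym unfolding cross_def by blast
    then show False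
      using noc a \<open>b \<in> A\<close> by blast
  qed
  have ne: "R \<inter> A \<noteq> {}" "R - A \<noteq> {}"
  proof -
    show "R \<inter> A \<noteq> {}"
    proof
      assume 0: "R \<inter> A = {}"
      then obtain a where "a \<in> A" "a \<in> ?Z" using A by blast
      then show False using out_A 0 by (metis Diff_triv)
    qed
    show "R - A \<noteq> {}"
    proof
      assume 0: "R - A = {}"
      then obtain a where "a \<notin> A" "a \<in> ?Z" using A by blast
      then show False using in_A 0 by (metis Diff_eq_empty_iff Int_absorb2 subsetD)
    qed
  qed
  have "card (R \<inter> A) + card (R - A) = card R"
    using assms(1) by (metis card_Un_disjoint finite_Int finite_Diff Int_Diff_Un Int_Diff_disjoint)
  moreover have "card (R \<inter> A) < card (nbrs E (R \<inter> A) \<inter> X)"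
    "card (R - A) < card (nbrs E (R - A) \<inter> X)"
    using assms(3) ne by (auto intro!: surplusD)
  moreover have "card (nbrs E (R \<inter> A) \<inter> X) + card (nbrs E (R - A) \<inter> X)
    = card ((nbrs E (R \<inter> A) \<inter> X) \<union> (nbrs E (R - A) \<inter> X))"
    using in_A out_A assms(2) by (intro card_Un_disjoint[symmetric]) auto
  moreover have "\<dots> \<le> card ?Z"
    using assms(2) by (intro card_mono) (auto simp: nbrs_def)
  ultimately show False using assms(4) by linarith
qed

section \<open>Surplus on independent sets and good pairs\<close>

text \<open>Only adjacency and the surplus of independent subsets of \<open>D\<close> are kept from
  the multigraph: these survive the contraction below, whereas degrees in general do not.\<close>

locale surplus_graph =
  fixes V :: "'a set" and E :: "'a \<Rightarrow> 'a \<Rightarrow> bool" and D :: "'a set"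
  assumes finite_V: "finite V"
    and E_V: "E a b \<Longrightarrow> a \<in> V"
    and sym: "E a b \<Longrightarrow> E b a"
    and irrefl: "\<not> E a a"
    and connected: "cut_connected V E"
    and indep_surplus: "S \<subseteq> D \<Longrightarrow> S \<subseteq> V \<Longrightarrow> S \<noteq> {} \<Longrightarrow> (\<And>a b. a \<in> S \<Longrightarrow> b \<in> S \<Longrightarrow> \<not> E a b)
      \<Longrightarrow> card S < card (nbrs E S)"
begin

lemma nbrs_subset: "nbrs E S \<subseteq> V"
  unfolding nbrs_def using E_V sym by blast

lemma finite_nbrs [simp]: "finite (nbrs E S)"
  using nbrs_subset finite_V finite_subset by blast

text \<open>\<open>X\<close> is to be the type-0 part, so surplus is asked only of the vertices of
  \<open>D\<close> in \<open>Y\<close>, those that must not become leaves. The pair need not cover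
  \<open>V\<close>.\<close>

definition good :: "'a set \<Rightarrow> 'a set \<Rightarrow> bool" where
  "good X Y \<longleftrightarrow> X \<subseteq> V \<and> Y \<subseteq> V \<and> X \<inter> Y = {} \<and> cut_connected (X \<union> Y) (cross X Y E) \<and>
     surplus E X (Y \<inter> D)"

text \<open>Starting point of the maximisation: in the star at \<open>w\<close>, surplus is the
  hypothesis on the independent set \<open>{w}\<close>.\<close>

lemma good_star:
  assumes "E w x"
  shows "good (nbrs E {w}) {w}"
  unfolding good_def
proof (intro conjI)
  show "cut_connected (nbrs E {w} \<union> {w}) (cross (nbrs E {w}) {w} E)"
    unfolding cut_connected_def
  proof (intro allI impI)
    fix A assume A: "A \<subseteq> nbrs E {w} \<union> {w}" "A \<noteq> {}" "A \<noteq> nbrs E {w} \<union> {w}"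
    show "\<exists>a\<in>A. \<exists>b\<in>nbrs E {w} \<union> {w} - A. cross (nbrs E {w}) {w} E a b"
    proof (cases "w \<in> A")
      case True
      then obtain b where "b \<in> nbrs E {w}" "b \<notin> A" using A by blast
      with True show ?thesis by (auto simp: nbrs_def cross_def)
    next
      case False
      then obtain b where "b \<in> nbrs E {w}" "b \<in> A" using A by blast
      with False show ?thesis using sym[of w b] by (auto simp: nbrs_def cross_def)
    qed
  qed
  show "surplus E (nbrs E {w}) ({w} \<inter> D)"
    unfolding surplus_def
  proof (intro allI impI)
    fix S assume "S \<subseteq> {w} \<inter> D" "S \<noteq> {}"
    then have "S = {w}" "w \<in> D" by auto
    then show "card S < card (nbrs E S \<inter> nbrs E {w})"
      using indep_surplus[of S] irrefl E_V[OF assms] by auto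
  qed
qed (use nbrs_subset E_V[OF assms] irrefl in \<open>auto simp: nbrs_def\<close>)

lemma good_insert_left:
  assumes "good X Y" "u \<in> V" "u \<notin> Y" "y \<in> Y" "E u y"
  shows "good (insert u X) Y"
proof -
  have "cut_connected (insert u (X \<union> Y)) (cross (insert u X) Y E)"
  proof (rule cut_connected_insert[where v = y])
    show "cut_connected (X \<union> Y) (cross (insert u X) Y E)"
      using assms(1) unfolding good_def by (auto simp: cross_def elim!: cut_connected_mono)
  qed (use assms sym[of u y] in \<open>auto simp: cross_def\<close>)
  moreover have "surplus E (insert u X) (Y \<inter> D)"
    using assms finite_V unfolding good_def
    by (auto intro!: surplus_mono[of E X "Y \<inter> D"] dest: finite_subset)
  ultimately show ?thesis
    using assms unfolding good_def by auto
qed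

text \<open>In contrast to an addition to \<open>X\<close>, one to \<open>Y\<close> may destroy
  surplus, so only connectivity carries over.\<close>

lemma cut_connected_insert_right:
  assumes "good X Y" "x \<in> X" "E u x"
  shows "cut_connected (X \<union> insert u Y) (cross X (insert u Y) E)"
proof -
  have "cut_connected (insert u (X \<union> Y)) (cross X (insert u Y) E)"
  proof (rule cut_connected_insert[where v = x])
    show "cut_connected (X \<union> Y) (cross X (insert u Y) E)"
      using assms(1) unfolding good_def by (auto simp: cross_def elim!: cut_connected_mono)
  qed (use assms sym[of u x] in \<open>auto simp: cross_def\<close>)
  then show ?thesis by simp
qed

text \<open>\<open>R\<close> is independent, so all its nonempty subsets have surplus, and that of
  \<open>R\<close> itself is exactly one, as \<open>cut_connected_tight\<close> requires.\<close>

lemma nbrs_tight_connected: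
  assumes "R \<subseteq> D" "R \<subseteq> V" "nbrs E R \<inter> R = {}" "card (nbrs E R) = Suc (card R)"
  shows "cut_connected (R \<union> nbrs E R) (cross (nbrs E R) R E)"
proof -
  have "surplus E (nbrs E R) R"
    unfolding surplus_def
  proof (intro allI impI)
    fix S assume S: "S \<subseteq> R" "S \<noteq> {}"
    have "card S < card (nbrs E S)"
    proof (rule indep_surplus)
      show "\<not> E a b" if "a \<in> S" "b \<in> S" for a b
        using that S assms(3) unfolding nbrs_def by blast
    qed (use S assms in auto)
    moreover have "nbrs E S \<inter> nbrs E R = nbrs E S"
      using nbrs_mono[OF S(1)] by blast
    ultimately show "card S < card (nbrs E S \<inter> nbrs E R)"
      by simp
  qed
  then show ?thesis
    using cut_connected_tight[of R "nbrs E R" E] assms(2,4) finite_V sym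
    by (auto dest: finite_subset)
qed

section \<open>Tight sets from a maximal good pair\<close>

text \<open>A vertex \<open>u\<close> outside the pair but adjacent to \<open>X\<close> must spoil
  surplus when added to \<open>Y\<close>. Let \<open>S\<close> be a smallest set without surplus.
  Maximality forces every vertex of \<open>S - {w}\<close> to have all its neighbours in
  \<open>X\<close>, so \<open>R = S - {w}\<close> is independent and has surplus; since
  \<open>S\<close> has none, \<open>w\<close> lies in \<open>S\<close> and the surplus of
  \<open>R\<close> is one.\<close>

lemma maximal_good_tight:
  assumes good: "good X Y" and w: "w \<in> Y" and x: "x \<in> X" and wx: "E w x"
    and ne: "X \<union> Y \<noteq> V"
    and max: "\<And>X' Y'. good X' Y' \<Longrightarrow> w \<in> Y' \<Longrightarrow> x \<in> X' \<Longrightarrow> card (X' \<union> Y') \<le> card (X \<union> Y)"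
  obtains R where "R \<noteq> {}" "R \<subseteq> D" "R \<subseteq> V" "w \<notin> R" "w \<notin> nbrs E R" "x \<in> nbrs E R"
    "nbrs E R \<inter> R = {}" "card (nbrs E R) = Suc (card R)"
proof -
  have XY: "X \<subseteq> V" "Y \<subseteq> V" "X \<inter> Y = {}" "cut_connected (X \<union> Y) (cross X Y E)"
    and surp: "surplus E X (Y \<inter> D)"
    using good by (auto simp: good_def)
  have fin: "finite X" "finite Y"
    using XY finite_V by (auto intro: finite_subset)
  have max': False
    if "good X' Y'" "w \<in> Y'" "x \<in> X'" "X \<union> Y \<subset> X' \<union> Y'" for X' Y'
  proof -
    have "finite (X' \<union> Y')"
      using that(1) finite_V unfolding good_def by (auto intro: finite_subset)
    then show False
      using max[OF that(1-3)] psubset_card_mono[OF _ that(4)] by simp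
  qed
  \<comment> \<open>A vertex outside the pair with a neighbour in \<open>Y\<close> could join
    \<open>X\<close>; so every edge leaving \<open>X \<union> Y\<close> starts in
    \<open>X\<close>.\<close>
  have Y_out: "v \<in> X \<union> Y" if v: "v \<in> V" "y \<in> Y" "E v y" for v y
  proof (rule ccontr)
    assume "v \<notin> X \<union> Y"
    then show False
      using max'[of "insert v X" Y] good_insert_left[OF good v(1) _ v(2,3)] w x by blast
  qed
  obtain u x0 where u: "u \<in> V" "u \<notin> X \<union> Y" and x0: "x0 \<in> X" "E u x0"
  proof -
    have "X \<union> Y \<subseteq> V" "X \<union> Y \<noteq> {}"
      using XY w by auto
    then obtain a b where ab: "a \<in> X \<union> Y" "b \<in> V" "b \<notin> X \<union> Y" "E a b"
      using cut_connectedD[OF connected] ne by metis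
    then have "a \<in> X"
      using Y_out[OF ab(2) _ sym[OF ab(4)]] by blast
    then show thesis
      using that ab sym by blast
  qed
  define Yu where "Yu = insert u Y"
  have Yu: "Yu \<subseteq> V" "X \<inter> Yu = {}" "finite Yu" "w \<in> Yu" "u \<in> Yu"
    using XY u fin w by (auto simp: Yu_def)
  have conn_u: "cut_connected (X \<union> Yu) (cross X Yu E)"
    unfolding Yu_def by (rule cut_connected_insert_right[OF good x0])
  have not_surp: "\<not> surplus E X (Yu \<inter> D)"
  proof
    assume "surplus E X (Yu \<inter> D)"
    then have "good X Yu"
      using XY Yu conn_u unfolding good_def by blast
    then show False
      using max'[of X Yu] w x u by (auto simp: Yu_def)
  qed
  \<comment> \<open>Adding \<open>u\<close> to a nonempty set lowers its surplus by at most one, and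
    \<open>{u}\<close> itself has the neighbour \<open>x0\<close>.\<close>
  have weak: "card S \<le> card (nbrs E S \<inter> X)" if S: "S \<subseteq> Yu \<inter> D" "S \<noteq> {}" for S
  proof (cases "S = {u}")
    case True
    then have "{x0} \<subseteq> nbrs E S \<inter> X"
      using x0 by (auto simp: nbrs_def)
    then have "card {x0} \<le> card (nbrs E S \<inter> X)"
      by (intro card_mono) auto
    then show ?thesis
      using True by simp
  next
    case False
    have finS: "finite S"
      using S Yu(3) finite_subset by blast
    have "card (S - {u}) < card (nbrs E (S - {u}) \<inter> X)"
      using S False by (intro surplusD[OF surp]) (auto simp: Yu_def)
    also have "\<dots> \<le> card (nbrs E S \<inter> X)"
      by (intro card_mono Int_mono nbrs_mono) auto
    finally show ?thesis
      using finS by (cases "u \<in> S") auto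
  qed
  \<comment> \<open>Otherwise \<open>u\<close> could join \<open>Y\<close> together with a neighbour
    \<open>v\<close> joining \<open>X\<close>: for sets containing \<open>u\<close>, the new
    neighbour \<open>v\<close> makes the weak inequality strict.\<close>
  have nbrs_u: "nbrs E {u} \<subseteq> X"
  proof
    fix v assume "v \<in> nbrs E {u}"
    then have uv: "E u v" "E v u"
      using sym by (auto simp: nbrs_def)
    show "v \<in> X"
    proof (rule ccontr)
      assume "v \<notin> X"
      have v: "v \<in> V" "v \<notin> Yu"
        using E_V[OF uv(2)] Y_out[OF u(1) _ uv(1)] u uv irrefl by (auto simp: Yu_def)
      have "cut_connected (insert v (X \<union> Yu)) (cross (insert v X) Yu E)"
      proof (rule cut_connected_insert[where v = u])
        show "cut_connected (X \<union> Yu) (cross (insert v X) Yu E)"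
          using conn_u by (rule cut_connected_mono) (auto simp: cross_def)
      qed (use Yu uv in \<open>auto simp: cross_def\<close>)
      moreover have "surplus E (insert v X) (Yu \<inter> D)"
        unfolding surplus_def
      proof (intro allI impI)
        fix S assume S: "S \<subseteq> Yu \<inter> D" "S \<noteq> {}"
        show "card S < card (nbrs E S \<inter> insert v X)"
        proof (cases "u \<in> S")
          case True
          have "card S < card (insert v (nbrs E S \<inter> X))"
            using weak[OF S] \<open>v \<notin> X\<close> by simp
          also have "insert v (nbrs E S \<inter> X) = nbrs E S \<inter> insert v X"
            using True uv by (auto simp: nbrs_def)
          finally show ?thesis .
        next
          case False
          then have "card S < card (nbrs E S \<inter> X)"
            using S by (intro surplusD[OF surp]) (auto simp: Yu_def)
          also have "\<dots> \<le> card (nbrs E S \<inter> insert v X)"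
            by (intro card_mono) auto
          finally show ?thesis .
        qed
      qed
      ultimately have "good (insert v X) Yu"
        using XY Yu v unfolding good_def by simp
      then show False
        using max'[of "insert v X" Yu] w x u by (auto simp: Yu_def)
    qed
  qed
  define bad where "bad S \<longleftrightarrow> S \<subseteq> Yu \<inter> D \<and> S \<noteq> {} \<and> card (nbrs E S \<inter> X) \<le> card S" for S
  have "\<exists>S. bad S"
    using not_surp unfolding surplus_def bad_def by (meson not_le)
  then obtain S where "bad S" and least: "\<And>T. bad T \<Longrightarrow> card S \<le> card T"
    using ex_has_least_nat[of bad _ card] by blast
  then have S: "S \<subseteq> Yu" "S \<subseteq> D" "S \<noteq> {}" "card (nbrs E S \<inter> X) \<le> card S"
    by (auto simp: bad_def)
  have finS: "finite S"
    using S(1) Yu(3) finite_subset by blast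
  have uT: "u \<in> T" if "bad T" for T
  proof (rule ccontr)
    assume "u \<notin> T"
    then have "card T < card (nbrs E T \<inter> X)"
      using that by (intro surplusD[OF surp]) (auto simp: bad_def Yu_def)
    then show False
      using that by (simp add: bad_def)
  qed
  have uS: "u \<in> S"
    using uT \<open>bad S\<close> .
  have minS: "card T < card (nbrs E T \<inter> X)" if "T \<subset> S" "T \<noteq> {}" for T
  proof (rule ccontr)
    assume "\<not> ?thesis"
    then have "bad T"
      using that S by (auto simp: bad_def)
    then show False
      using least[of T] psubset_card_mono[OF finS that(1)] by simp
  qed
  have S_u: "S \<noteq> {u}"
  proof
    assume "S = {u}"
    moreover have "card {u} < card (nbrs E {u})"
      using u irrefl S \<open>S = {u}\<close> by (intro indep_surplus) auto
    moreover have "nbrs E {u} \<inter> X = nbrs E {u}"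
      using nbrs_u by blast
    ultimately show False
      using S(4) by simp
  qed
  \<comment> \<open>The pair \<open>(X, Yu - {s})\<close> turns out to be good. If \<open>s\<close>
    had a neighbour in \<open>Yu\<close>, then \<open>s\<close> could be put into \<open>X\<close>,
    and the pair would cover \<open>u\<close> as well. The case \<open>s = w\<close> is excluded
    because \<open>w\<close> must stay in \<open>Y\<close>.\<close>
  have nbrs_s: "nbrs E {s} \<subseteq> X" if s: "s \<in> S" "s \<noteq> w" for s
  proof -
    define Y' where "Y' = Yu - {s}"
    define R where "R = S - {s}"
    have R: "R \<noteq> {}" "R \<subset> S" "R \<subseteq> Y'" "Suc (card R) = card S"
      using S_u uS s S(1) finS card_Suc_Diff1[OF finS s(1)] by (auto simp: R_def Y'_def)
    have sX: "s \<in> Yu" "s \<notin> X"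
      using s S(1) Yu by auto
    \<comment> \<open>\<open>R\<close> has surplus at least one and \<open>S\<close> has none, so
      dropping \<open>s\<close> loses no neighbour. All neighbours of \<open>s\<close> in
      \<open>X\<close> thus lie in the connected part spanned by \<open>R\<close> and its
      neighbourhood, and \<open>s\<close> can be removed.\<close>
    have nR: "nbrs E R \<inter> X = nbrs E S \<inter> X"
    proof (rule card_subset_eq)
      show "card (nbrs E R \<inter> X) = card (nbrs E S \<inter> X)"
      proof (rule antisym)
        show "card (nbrs E R \<inter> X) \<le> card (nbrs E S \<inter> X)"
          using R(2) by (intro card_mono Int_mono nbrs_mono) auto
        show "card (nbrs E S \<inter> X) \<le> card (nbrs E R \<inter> X)"
          using minS[OF R(2,1)] S(4) R(4) by simp
      qed
    qed (use nbrs_mono[of R S E] R(2) in auto)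
    have "cut_connected (X \<union> Y') (cross X Yu E)"
    proof (rule cut_connected_remove[where s = s and K = "R \<union> (nbrs E R \<inter> X)"])
      have "insert s (X \<union> Y') = X \<union> Yu"
        using sX by (auto simp: Y'_def)
      then show "cut_connected (insert s (X \<union> Y')) (cross X Yu E)"
        using conn_u by simp
      show "s \<notin> X \<union> Y'"
        using sX by (auto simp: Y'_def)
      show "R \<union> (nbrs E R \<inter> X) \<subseteq> X \<union> Y'"
        using R(3) by auto
      have "cut_connected (R \<union> (nbrs E R \<inter> X)) (cross X R E)"
      proof (rule cut_connected_tight)
        show "surplus E X R"
          using minS R(2) unfolding surplus_def by (meson subset_psubset_trans)
        show "card (nbrs E R \<inter> X) \<le> Suc (card R)"
          using nR S(4) R(4) by simp
      qed (use fin finS sym R_def in auto)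
      then show "cut_connected (R \<union> (nbrs E R \<inter> X)) (cross X Yu E)"
        by (rule cut_connected_mono) (use R(2) S(1) in \<open>auto simp: cross_def\<close>)
    next
      fix v assume v: "cross X Yu E s v \<or> cross X Yu E v s"
      then have "E s v" "v \<in> X"
        using sX Yu(2) sym unfolding cross_def by blast+
      then have "v \<in> nbrs E S \<inter> X"
        using s by (auto simp: nbrs_def)
      then show "v \<in> R \<union> (nbrs E R \<inter> X)"
        using nR by simp
    qed
    then have conn': "cut_connected (X \<union> Y') (cross X Y' E)"
      by (rule cut_connected_mono) (use sX in \<open>auto simp: cross_def Y'_def\<close>)
    \<comment> \<open>A set \<open>T\<close> without surplus contains \<open>u\<close>, so
      \<open>S \<inter> T\<close> is nonempty; it misses \<open>s\<close> and so has surplus. As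
      \<open>S \<union> T\<close> still satisfies the weak inequality, this contradicts
      submodularity.\<close>
    have "surplus E X (Y' \<inter> D)"
      unfolding surplus_def
    proof (intro allI impI, rule ccontr)
      fix T assume T: "T \<subseteq> Y' \<inter> D" "T \<noteq> {}" "\<not> card T < card (nbrs E T \<inter> X)"
      have finT: "finite T"
        using T Yu(3) finite_subset[of T Yu] unfolding Y'_def by blast
      have "bad T"
        using T by (auto simp: bad_def Y'_def)
      then have "u \<in> S \<inter> T"
        using uT uS by blast
      moreover have "S \<inter> T \<subset> S"
        using T s by (auto simp: Y'_def)
      ultimately have "card (S \<inter> T) < card (nbrs E (S \<inter> T) \<inter> X)"
        using minS by blast
      moreover have "card (S \<union> T) \<le> card (nbrs E (S \<union> T) \<inter> X)"
        using S T by (intro weak) (auto simp: Y'_def)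
      moreover have "card S + card T = card (S \<union> T) + card (S \<inter> T)"
        using card_Un_Int finS finT by blast
      ultimately show False
        using card_nbrs_submodular[OF fin(1), of E S T] S(4) T(3) by linarith
    qed
    then have good': "good X Y'"
      using XY Yu conn' unfolding good_def Y'_def by blast
    show ?thesis
    proof
      fix v assume "v \<in> nbrs E {s}"
      then have v: "E s v" "v \<in> V"
        using nbrs_subset by (auto simp: nbrs_def)
      have "v \<notin> Yu"
      proof
        assume "v \<in> Yu"
        then have "v \<in> Y'"
          using v irrefl by (auto simp: Y'_def)
        then have "good (insert s X) Y'"
          using good_insert_left[OF good' E_V[OF v(1)] _ _ v(1)] by (simp add: Y'_def)
        moreover have "X \<union> Y \<subset> insert s X \<union> Y'"
          using u sX by (auto simp: Y'_def Yu_def)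
        ultimately show False
          using max'[of "insert s X" Y'] w x s(2) by (auto simp: Y'_def Yu_def)
      qed
      moreover have "v \<in> X \<union> Y" if "s \<noteq> u"
        using Y_out[OF v(2) _ sym[OF v(1)]] that sX by (auto simp: Yu_def)
      moreover have "v \<in> X" if "s = u"
        using nbrs_u v that by (auto simp: nbrs_def)
      ultimately show "v \<in> X"
        by (auto simp: Yu_def)
    qed
  qed
  define R where "R = S - {w}"
  have nR: "nbrs E R \<subseteq> X"
    using nbrs_s unfolding R_def nbrs_def by blast
  have R: "R \<noteq> {}" "R \<subseteq> D" "R \<subseteq> V" "R \<inter> X = {}"
    using uS u w S Yu by (auto simp: R_def)
  \<comment> \<open>The chain \<open>card R < card (nbrs E R) \<le> card (nbrs E S \<inter> X) \<le>
    card S\<close> leaves no slack: \<open>w\<close> is in \<open>S\<close>, and \<open>R\<close>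
    already has every neighbour of \<open>S\<close> in \<open>X\<close>, among them
    \<open>x\<close>.\<close>
  have cR: "card R < card (nbrs E R)"
  proof (rule indep_surplus)
    show "\<not> E a b" if "a \<in> R" "b \<in> R" for a b
      using that nR R(4) unfolding nbrs_def by blast
  qed (use R in auto)
  have sub: "nbrs E R \<subseteq> nbrs E S \<inter> X"
    using nR nbrs_mono[of R S E] by (auto simp: R_def)
  then have le: "card (nbrs E R) \<le> card (nbrs E S \<inter> X)"
    by (intro card_mono) auto
  then have "card R < card S"
    using cR S(4) by linarith
  then have wS: "w \<in> S"
    unfolding R_def by (metis Diff_empty Diff_insert0 less_irrefl)
  then have "card S = Suc (card R)"
    unfolding R_def using card_Suc_Diff1[OF finS] by simp
  then have eq: "card (nbrs E R) = Suc (card R)" "card (nbrs E R) = card (nbrs E S \<inter> X)"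
    using cR le S(4) by linarith+
  have "nbrs E R = nbrs E S \<inter> X"
    using sub eq(2) by (intro card_subset_eq) auto
  moreover have "x \<in> nbrs E S"
    using wS wx by (auto simp: nbrs_def)
  ultimately have "x \<in> nbrs E R"
    using x by blast
  moreover have "w \<notin> nbrs E R"
    using nR Yu by blast
  ultimately show thesis
    using that[of R] R nR eq(1) by (auto simp: R_def)
qed

end

section \<open>Contraction of a tight set\<close>

text \<open>Deleting \<open>R\<close> and identifying its neighbourhood to the vertex \<open>x\<close> preserves the hypotheses because
  the neighbourhood exceeds \<open>R\<close> by exactly one, so that it counts as the single vertex \<open>x\<close>.\<close>

locale tight_set = surplus_graph +
  fixes R x
  assumes R: "R \<noteq> {}" "R \<subseteq> D" "R \<subseteq> V"
    and indep: "nbrs E R \<inter> R = {}"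
    and tight: "card (nbrs E R) = Suc (card R)"
    and x: "x \<in> nbrs E R"
begin

text \<open>\<open>R\<close> goes to \<open>x\<close> as well instead of being deleted. Its edges
  all end in \<open>nbrs E R\<close>, so they turn into loops, which \<open>contracted\<close>
  drops.\<close>

definition collapse :: "'a \<Rightarrow> 'a" where
  "collapse v = (if v \<in> R \<union> nbrs E R then x else v)"

definition contracted :: "'a \<Rightarrow> 'a \<Rightarrow> bool" where
  "contracted a b \<longleftrightarrow> a \<noteq> b \<and> (\<exists>a' b'. E a' b' \<and> collapse a' = a \<and> collapse b' = b)"

lemma R_nbrs: "a \<in> R \<Longrightarrow> E a b \<Longrightarrow> b \<in> nbrs E R" "a \<in> R \<Longrightarrow> E b a \<Longrightarrow> b \<in> nbrs E R"
  unfolding nbrs_def using sym by blast+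

lemma collapse_other: "collapse v = u \<Longrightarrow> u \<noteq> x \<Longrightarrow> v = u \<and> u \<notin> R \<and> u \<notin> nbrs E R"
  by (auto simp: collapse_def split: if_splits)

lemma collapse_image: "collapse ` V = insert x (V - (R \<union> nbrs E R))"
  using R(3) nbrs_subset x by (auto simp: collapse_def)

text \<open>Vertices of \<open>T\<close> are their own only preimages under \<open>collapse\<close>,
  so only the far ends of their edges move.\<close>

lemma contracted_nbrs:
  assumes "T \<subseteq> collapse ` V - {x}"
  shows "nbrs contracted T = collapse ` nbrs E T"
proof
  have T: "collapse t = t" "collapse t' = t \<Longrightarrow> t' = t" if "t \<in> T" for t t'
    using that assms collapse_other[of t' t] collapse_image by (auto simp: collapse_def)
  show "nbrs contracted T \<subseteq> collapse ` nbrs E T"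
  proof
    fix b assume "b \<in> nbrs contracted T"
    then obtain a' b' where "collapse a' \<in> T" "E a' b'" "b = collapse b'"
      by (auto simp: nbrs_def contracted_def)
    moreover from this have "a' \<in> T"
      using T(2)[of "collapse a'" a'] by simp
    ultimately show "b \<in> collapse ` nbrs E T"
      by (auto simp: nbrs_def)
  qed
  show "collapse ` nbrs E T \<subseteq> nbrs contracted T"
  proof
    fix b assume "b \<in> collapse ` nbrs E T"
    then obtain t b' where "t \<in> T" "E t b'" "b = collapse b'"
      unfolding nbrs_def by blast
    moreover from this have "t \<noteq> collapse b'"
      using T(2)[of t b'] irrefl by metis
    ultimately show "b \<in> nbrs contracted T"
      using T(1)[of t] by (force simp: nbrs_def contracted_def)
  qed
qed

text \<open>Neighbours of \<open>T\<close> outside \<open>nbrs E R\<close> are fixed by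
  \<open>collapse\<close>, as none of them lies in \<open>R\<close>; those inside all become
  \<open>x\<close>.\<close>

lemma contracted_nbrs_Int:
  assumes T: "T \<subseteq> collapse ` V - {x}" and X: "x \<in> X" "X \<subseteq> collapse ` V"
  shows "nbrs contracted T \<inter> X =
    (nbrs E T \<inter> X - nbrs E R) \<union> (if nbrs E T \<inter> nbrs E R = {} then {} else {x})"
proof -
  have disj: "b \<notin> R" if "b \<in> nbrs E T" for b
    using that R_nbrs(2) T collapse_image unfolding nbrs_def by blast
  have "collapse ` (nbrs E T - nbrs E R) = id ` (nbrs E T - nbrs E R)"
    using disj by (intro image_cong) (auto simp: collapse_def)
  moreover have "collapse ` (nbrs E T \<inter> nbrs E R) = (\<lambda>_. x) ` (nbrs E T \<inter> nbrs E R)"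
    by (intro image_cong) (auto simp: collapse_def)
  moreover have "collapse ` nbrs E T = collapse ` (nbrs E T - nbrs E R) \<union> collapse ` (nbrs E T \<inter> nbrs E R)"
    by (metis Un_Diff_Int image_Un)
  ultimately have "collapse ` nbrs E T =
    (nbrs E T - nbrs E R) \<union> (if nbrs E T \<inter> nbrs E R = {} then {} else {x})"
    by (simp add: image_constant_conv)
  then show ?thesis
    unfolding contracted_nbrs[OF T] using X(1) by auto
qed

lemma card_contracted_nbrs:
  assumes T: "T \<subseteq> collapse ` V - {x}" and X: "x \<in> X" "X \<subseteq> collapse ` V"
  shows "card (nbrs contracted T \<inter> X) =
    card (nbrs E T \<inter> X - nbrs E R) + (if nbrs E T \<inter> nbrs E R = {} then 0 else 1)"
  unfolding contracted_nbrs_Int[OF assms] using x by (auto simp: card_insert_if)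

text \<open>If \<open>S\<close> has neighbours in \<open>nbrs E R\<close>, the hypothesis is applied
  to \<open>S \<union> R\<close>: the \<open>card R + 1\<close> vertices of \<open>nbrs E R\<close>
  pay for \<open>R\<close> and for the one vertex \<open>x\<close>. The vertex \<open>x\<close>
  leaves \<open>D\<close>, since it stands for several vertices and will be placed in
  \<open>X\<close>.\<close>

sublocale contr: surplus_graph "collapse ` V" contracted "D - {x}"
proof
  show "finite (collapse ` V)"
    using finite_V by simp
  show "a \<in> collapse ` V" if "contracted a b" for a b
    using that E_V by (auto simp: contracted_def)
  show "contracted b a" if "contracted a b" for a b
    using that sym unfolding contracted_def by metis
  show "\<not> contracted a a" for a
    by (simp add: contracted_def)
  show "cut_connected (collapse ` V) contracted"
    unfolding cut_connected_def
  proof (intro allI impI)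
    fix A assume A: "A \<subseteq> collapse ` V" "A \<noteq> {}" "A \<noteq> collapse ` V"
    then have "V \<inter> collapse -` A \<noteq> {}" "V \<inter> collapse -` A \<noteq> V" "V \<inter> collapse -` A \<subseteq> V"
      by auto
    then obtain a b where "a \<in> V \<inter> collapse -` A" "b \<in> V" "b \<notin> V \<inter> collapse -` A" "E a b"
      using cut_connectedD[OF connected] by metis
    then have "collapse a \<in> A" "collapse b \<in> collapse ` V - A" "contracted (collapse a) (collapse b)"
      by (auto simp: contracted_def)
    then show "\<exists>a\<in>A. \<exists>b\<in>collapse ` V - A. contracted a b"
      by blast
  qed
  fix S assume S: "S \<subseteq> D - {x}" "S \<subseteq> collapse ` V" "S \<noteq> {}"
    and ind: "\<And>a b. a \<in> S \<Longrightarrow> b \<in> S \<Longrightarrow> \<not> contracted a b"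
  have S': "S \<subseteq> collapse ` V - {x}" "S \<subseteq> V" "S \<inter> R = {}" "S \<inter> nbrs E R = {}" "S \<subseteq> D"
    using S collapse_image by auto
  have fS: "collapse a = a" if "a \<in> S" for a
    using that S' by (auto simp: collapse_def)
  have indS: "\<not> E a b" if "a \<in> S" "b \<in> S" for a b
    using ind[OF that] fS that irrefl unfolding contracted_def by blast
  have nS: "nbrs E S \<inter> collapse ` V - nbrs E R = nbrs E S - nbrs E R"
    using R_nbrs S' nbrs_subset[of S] unfolding collapse_image by (auto simp: nbrs_def)
  have "nbrs contracted S \<inter> collapse ` V = nbrs contracted S"
    using S'(1) nbrs_subset by (auto simp: contracted_nbrs)
  then have card_eq: "card (nbrs contracted S) =
      card (nbrs E S - nbrs E R) + (if nbrs E S \<inter> nbrs E R = {} then 0 else 1)"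
    using card_contracted_nbrs[OF S'(1), of "collapse ` V"] collapse_image nS by simp
  show "card S < card (nbrs contracted S)"
  proof (cases "nbrs E S \<inter> nbrs E R = {}")
    case True
    then have "nbrs E S - nbrs E R = nbrs E S"
      by blast
    then show ?thesis
      using card_eq True indep_surplus[OF S'(5,2) S(3) indS] by simp
  next
    case False
    have "card (S \<union> R) < card (nbrs E (S \<union> R))"
    proof (rule indep_surplus)
      show "\<not> E a b" if "a \<in> S \<union> R" "b \<in> S \<union> R" for a b
        using that indS R_nbrs S' indep by blast
    qed (use R S' in auto)
    moreover have "nbrs E (S \<union> R) = (nbrs E S - nbrs E R) \<union> nbrs E R"
      by (auto simp: nbrs_Un)
    then have "card (nbrs E (S \<union> R)) = card (nbrs E S - nbrs E R) + card (nbrs E R)"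
      using card_Un_disjoint[of "nbrs E S - nbrs E R" "nbrs E R"] by auto
    moreover have "card (S \<union> R) = card S + card R"
      using S' R finite_V by (intro card_Un_disjoint) (auto intro: finite_subset)
    ultimately show ?thesis
      using card_eq False tight by simp
  qed
qed

text \<open>Putting \<open>R\<close> into \<open>Y\<close> and its neighbourhood into
  \<open>X\<close> undoes the contraction. A set that had \<open>x\<close> as a neighbour now has at
  least one neighbour in \<open>nbrs E R\<close>, and a nonempty part inside \<open>R\<close> has
  surplus of its own there.\<close>

lemma good_expand:
  assumes "contr.good X Y" "X \<union> Y = collapse ` V" "x \<in> X"
  shows "good (X \<union> nbrs E R) (Y \<union> R)" and "X \<union> nbrs E R \<union> (Y \<union> R) = V"
proof -
  let ?Z = "nbrs E R"
  have XY: "X \<subseteq> collapse ` V" "Y \<subseteq> collapse ` V" "X \<inter> Y = {}" "cut_connected (X \<union> Y) (cross X Y contracted)"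
    and surp: "surplus contracted X (Y \<inter> (D - {x}))"
    using assms(1) by (auto simp: contr.good_def)
  have Y: "Y \<subseteq> V" "Y \<inter> R = {}" "Y \<inter> ?Z = {}" "x \<notin> Y"
    using XY assms(3) unfolding collapse_image by auto
  have X: "X \<subseteq> V" "X \<inter> R = {}"
    using XY(1) indep x subsetD[OF nbrs_subset x] unfolding collapse_image by auto
  show V: "X \<union> ?Z \<union> (Y \<union> R) = V"
    using assms(2) X(1) Y(1) nbrs_subset[of R] R(3) x unfolding collapse_image by blast
  have disj: "(X \<union> ?Z) \<inter> (Y \<union> R) = {}"
    using XY(3) X Y indep by blast
  have f_XY: "a' \<in> X \<union> ?Z" "b' \<in> Y" if "E a' b'" "collapse a' \<in> X" "collapse b' \<in> Y" for a' b'
  proof -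
    show b': "b' \<in> Y"
      using collapse_other[of b' "collapse b'"] that Y by metis
    show "a' \<in> X \<union> ?Z"
    proof (cases "a' \<in> R")
      case True
      then show ?thesis
        using R_nbrs(1)[OF True that(1)] b' Y by blast
    qed (use that in \<open>auto simp: collapse_def split: if_splits\<close>)
  qed
  have "cut_connected V (cross (X \<union> ?Z) (Y \<union> R) E)"
    unfolding cut_connected_def
  proof (intro allI impI)
    fix A assume A: "A \<subseteq> V" "A \<noteq> {}" "A \<noteq> V"
    let ?K = "R \<union> ?Z"
    \<comment> \<open>A cut that splits the connected set \<open>R \<union> nbrs E R\<close> is
      crossed inside it; any other cut consists of whole fibres of \<open>collapse\<close> and hence
      comes from a cut of the contraction.\<close>
    consider "A \<inter> ?K \<noteq> {}" "A \<inter> ?K \<noteq> ?K" | "A \<inter> ?K = {} \<or> ?K \<subseteq> A"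
      by blast
    then show "\<exists>a\<in>A. \<exists>b\<in>V - A. cross (X \<union> ?Z) (Y \<union> R) E a b"
    proof cases
      case 1
      obtain a b where "a \<in> A \<inter> ?K" "b \<in> ?K" "b \<notin> A \<inter> ?K" "cross ?Z R E a b"
        using cut_connectedD[OF nbrs_tight_connected[OF R(2,3) indep tight], of "A \<inter> ?K"] 1
        by (metis Int_lower2)
      moreover from this have "cross (X \<union> ?Z) (Y \<union> R) E a b" "b \<in> V"
        using R(3) nbrs_subset by (auto simp: cross_def)
      ultimately show ?thesis
        by blast
    next
      case 2
      have sat: "collapse v \<in> collapse ` A \<longleftrightarrow> v \<in> A" for v
      proof
        assume "collapse v \<in> collapse ` A"
        then obtain v' where "v' \<in> A" "collapse v = collapse v'"
          by blast
        then show "v \<in> A"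
          using 2 x unfolding collapse_def by (auto split: if_splits)
      qed simp
      have "collapse ` A \<subseteq> X \<union> Y" "collapse ` A \<noteq> {}"
        using A assms(2) by auto
      moreover have "collapse ` A \<noteq> X \<union> Y"
        using A assms(2) sat by (metis image_eqI subsetI subset_antisym)
      ultimately obtain a b where ab: "a \<in> collapse ` A" "b \<in> X \<union> Y" "b \<notin> collapse ` A"
        "cross X Y contracted a b"
        using cut_connectedD[OF XY(4)] by metis
      then obtain a' b' where a'b': "E a' b'" "collapse a' = a" "collapse b' = b"
        by (auto simp: cross_def contracted_def)
      then have "a' \<in> A" "b' \<notin> A" "b' \<in> V"
        using ab(1,3) sat E_V sym by metis+
      moreover have "cross (X \<union> ?Z) (Y \<union> R) E a' b'"
        using ab(4) f_XY[of a' b'] f_XY[of b' a'] a'b' sym[OF a'b'(1)]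
        unfolding cross_def by blast
      ultimately show ?thesis
        by blast
    qed
  qed
  moreover have "surplus E (X \<union> ?Z) ((Y \<union> R) \<inter> D)"
    unfolding surplus_def
  proof (intro allI impI)
    fix S assume S: "S \<subseteq> (Y \<union> R) \<inter> D" "S \<noteq> {}"
    define T where "T = S \<inter> Y"
    define U where "U = S \<inter> R"
    have STU: "S = T \<union> U" "T \<inter> U = {}" "T \<subseteq> Y \<inter> (D - {x})" "U \<subseteq> R" "U \<subseteq> D"
      using S Y by (auto simp: T_def U_def)
    have "S \<subseteq> V"
      using S(1) Y(1) R(3) by blast
    then have "finite S"
      using finite_V finite_subset by blast
    then have fin: "finite T" "finite U"
      by (simp_all add: T_def U_def)
    have cS: "card S = card T + card U"
      unfolding STU(1) by (rule card_Un_disjoint[OF fin STU(2)])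
    let ?N1 = "nbrs E T \<inter> X - ?Z"
    let ?N2 = "nbrs E S \<inter> ?Z"
    have fin': "finite X"
      using X finite_V finite_subset by blast
    have "card ?N1 + card ?N2 = card (?N1 \<union> ?N2)"
      using fin' by (intro card_Un_disjoint[symmetric]) auto
    also have "\<dots> \<le> card (nbrs E S \<inter> (X \<union> ?Z))"
      using nbrs_mono[of T S E] STU(1) by (intro card_mono) auto
    finally have sum: "card ?N1 + card ?N2 \<le> card (nbrs E S \<inter> (X \<union> ?Z))" .
    have T: "card T < card ?N1 + (if nbrs E T \<inter> ?Z = {} then 0 else 1)" if "T \<noteq> {}"
    proof -
      have "T \<subseteq> collapse ` V - {x}"
        using STU(3) XY(2) by blast
      then show ?thesis
        using surplusD[OF surp STU(3) that] card_contracted_nbrs[OF _ assms(3) XY(1), of T] by simp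
    qed
    have U: "card U < card ?N2" if "U \<noteq> {}"
    proof -
      have "card U < card (nbrs E U)"
      proof (rule indep_surplus)
        show "\<not> E a b" if "a \<in> U" "b \<in> U" for a b
          using that R_nbrs STU(4) indep by blast
      qed (use that STU R in auto)
      also have "\<dots> \<le> card ?N2"
        using nbrs_mono[of U S E] nbrs_mono[of U R E] STU by (intro card_mono) auto
      finally show ?thesis .
    qed
    have T': "1 \<le> card ?N2" if "nbrs E T \<inter> ?Z \<noteq> {}"
    proof -
      have "?N2 \<noteq> {}"
        using that nbrs_mono[of T S E] STU(1) by blast
      then show ?thesis
        by (simp add: Suc_le_eq card_gt_0_iff)
    qed
    \<comment> \<open>The possible unit for \<open>x\<close> in the bound on \<open>T\<close> is
      paid by \<open>?N2\<close>: by its being nonempty when \<open>U\<close> is empty, otherwise by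
      the strictness of the bound on \<open>U\<close>.\<close>
    show "card S < card (nbrs E S \<inter> (X \<union> ?Z))"
    proof (cases "T = {}")
      case True
      then have "U \<noteq> {}" "card T = 0"
        using S STU by auto
      then show ?thesis
        using U cS sum by linarith
    next
      case False
      have "card T < card ?N1 + (if nbrs E T \<inter> ?Z = {} then 0 else 1)"
        by (rule T[OF False])
      then show ?thesis
        using U T' cS sum by (cases "U = {}"; cases "nbrs E T \<inter> ?Z = {}") simp_all
    qed
  qed
  ultimately show "good (X \<union> ?Z) (Y \<union> R)"
    using X Y R(3) nbrs_subset disj V unfolding good_def by simp
qed

end

section \<open>Induction for a spanning good pair\<close>

text \<open>The contraction is smaller because \<open>R\<close> disappears, and the edge between
  \<open>w\<close> and \<open>x\<close> survives it because \<open>w\<close> lies neither in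
  \<open>R\<close> nor in its neighbourhood.\<close>

lemma spanning_good_exists:
  assumes "surplus_graph V E D" "E w x"
  shows "\<exists>X Y. surplus_graph.good V E D X Y \<and> X \<union> Y = V \<and> w \<in> Y \<and> x \<in> X"
  using assms
proof (induction "card V" arbitrary: V E D rule: less_induct)
  case less
  interpret surplus_graph V E D
    by fact
  define P where "P p \<longleftrightarrow> good (fst p) (snd p) \<and> w \<in> snd p \<and> x \<in> fst p" for p
  have "P (nbrs E {w}, {w})"
    using good_star[OF less.prems(2)] less.prems(2) by (simp add: P_def nbrs_def)
  moreover have "card (fst p \<union> snd p) \<le> card V" if "P p" for p
    using that finite_V by (intro card_mono) (auto simp: P_def good_def)
  then have "\<forall>p. P p \<longrightarrow> card (fst p \<union> snd p) < Suc (card V)"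
    by (simp add: less_Suc_eq_le)
  ultimately obtain p where p: "P p" and pmax: "\<And>q. P q \<Longrightarrow> card (fst q \<union> snd q) \<le> card (fst p \<union> snd p)"
    using ex_has_greatest_nat[of P _ "\<lambda>p. card (fst p \<union> snd p)" "Suc (card V)"] by metis
  obtain X Y where "p = (X, Y)"
    by force
  then have good: "good X Y" "w \<in> Y" "x \<in> X"
    and max: "\<And>X' Y'. good X' Y' \<Longrightarrow> w \<in> Y' \<Longrightarrow> x \<in> X' \<Longrightarrow> card (X' \<union> Y') \<le> card (X \<union> Y)"
    using p pmax[of "(_, _)"] by (auto simp: P_def)
  show ?case
  proof (cases "X \<union> Y = V")
    case True
    then show ?thesis
      using good by blast
  next
    case False
    obtain R where Rw: "R \<noteq> {}" "R \<subseteq> D" "R \<subseteq> V" "w \<notin> R" "w \<notin> nbrs E R" "x \<in> nbrs E R"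
      "nbrs E R \<inter> R = {}" "card (nbrs E R) = Suc (card R)"
    proof (rule maximal_good_tight[OF good less.prems(2) False])
      show "card (X' \<union> Y') \<le> card (X \<union> Y)" if "good X' Y'" "w \<in> Y'" "x \<in> X'" for X' Y'
        using max that by blast
    qed
    interpret tight_set V E D R x
      by unfold_locales (use Rw in auto)
    have fw: "collapse w = w" "collapse x = x" "w \<noteq> x"
      using Rw by (auto simp: collapse_def)
    obtain r where "r \<in> R"
      using Rw(1) by blast
    then have "r \<notin> collapse ` V" "r \<in> V"
      using Rw(3,6,7) unfolding collapse_image by auto
    moreover have "collapse ` V \<subseteq> V"
      using Rw(6) nbrs_subset[of R] unfolding collapse_image by blast
    ultimately have "collapse ` V \<subset> V"
      by blast
    then have "card (collapse ` V) < card V"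
      using finite_V psubset_card_mono by blast
    moreover have "contracted w x"
      using fw less.prems(2) unfolding contracted_def by blast
    ultimately obtain X2 Y2 where "contr.good X2 Y2" "X2 \<union> Y2 = collapse ` V" "w \<in> Y2" "x \<in> X2"
      using less.hyps[OF _ contr.surplus_graph_axioms] by blast
    then show ?thesis
      using good_expand[of X2 Y2] by blast
  qed
qed

section \<open>Bridges in edge-minimal bipartite graphs\<close>

text \<open>The edge set is a parameter because edges will be deleted one at a time; deleting one of
  several parallel edges leaves the relation unchanged.\<close>

definition link :: "('b \<Rightarrow> 'a set) \<Rightarrow> 'b set \<Rightarrow> 'a \<Rightarrow> 'a \<Rightarrow> bool" where
  "link en K a b \<longleftrightarrow> (\<exists>e \<in> K. en e = {a, b})"

lemma link_sym: "link en K a b \<Longrightarrow> link en K b a"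
  by (auto simp: link_def insert_commute)

text \<open>If all other edges at \<open>v\<close> were bridges, then \<open>v\<close> and the far sides of these bridges would form
  a set that only \<open>e\<close> leaves, so \<open>e\<close> would be a bridge too.\<close>

lemma nonbridge_adjacent:
  assumes conn: "cut_connected V (link en K)"
    and e: "e \<in> K" "en e = {v, z}" "v \<noteq> z" "v \<in> V" "z \<in> V"
    and nonbridge: "cut_connected V (link en (K - {e}))"
  shows "\<exists>g\<in>K. g \<noteq> e \<and> v \<in> en g \<and> cut_connected V (link en (K - {g}))"
proof (rule ccontr)
  assume "\<not> ?thesis"
  then have bridges: "\<not> cut_connected V (link en (K - {g}))"
    if "g \<in> K" "g \<noteq> e" "v \<in> en g" for g
    using that by blast
  define M where "M = {g \<in> K. g \<noteq> e \<and> v \<in> en g}"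
  \<comment> \<open>The far side of the bridge \<open>g\<close>, seen from \<open>v\<close>.\<close>
  have side: "\<exists>A \<subseteq> V. A \<noteq> {} \<and> v \<notin> A \<and> (\<forall>a\<in>A. \<forall>b\<in>V - A. \<not> link en (K - {g}) a b)"
    if g: "g \<in> M" for g
  proof -
    obtain A where A: "A \<subseteq> V" "A \<noteq> {}" "A \<noteq> V"
      "\<And>a b. a \<in> A \<Longrightarrow> b \<in> V - A \<Longrightarrow> \<not> link en (K - {g}) a b"
      using bridges[of g] g unfolding cut_connected_def M_def by blast
    show ?thesis
    proof (cases "v \<in> A")
      case True
      have "\<not> link en (K - {g}) a b" if "a \<in> V - A" "b \<in> V - (V - A)" for a b
        using A(4)[of b a] link_sym[of en "K - {g}" a b] that A(1) by blast
      then show ?thesis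
        using True A by (intro exI[of _ "V - A"]) auto
    next
      case False
      then show ?thesis
        using A by blast
    qed
  qed
  then obtain A where A: "\<And>g. g \<in> M \<Longrightarrow> A g \<subseteq> V \<and> A g \<noteq> {} \<and> v \<notin> A g \<and>
      (\<forall>a\<in>A g. \<forall>b\<in>V - A g. \<not> link en (K - {g}) a b)"
    by metis
  have crossing: "en g = {a, b} \<and> h = g"
    if "g \<in> M" "h \<in> K" "en h = {a, b}" "a \<in> A g" "b \<in> V - A g" for g h a b
    using A[OF that(1)] that unfolding link_def by blast
  define U where "U = insert v (\<Union>g\<in>M. A g)"
  have "z \<notin> U"
  proof
    assume "z \<in> U"
    then obtain g where g: "g \<in> M" "z \<in> A g"
      using e(3) by (auto simp: U_def)
    moreover have "v \<in> V - A g"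
      using A[OF g(1)] e(4) by blast
    ultimately have "e = g"
      using crossing[of g e z v] e by (auto simp: insert_commute)
    then show False
      using g by (simp add: M_def)
  qed
  then have "U \<subseteq> V" "U \<noteq> {}" "U \<noteq> V"
    using A e(4,5) by (auto simp: U_def)
  then obtain a b where ab: "a \<in> U" "b \<in> V" "b \<notin> U" "link en (K - {e}) a b"
    using cut_connectedD[OF nonbridge] by metis
  then obtain h where h: "h \<in> K" "h \<noteq> e" "en h = {a, b}"
    by (auto simp: link_def)
  \<comment> \<open>An edge \<open>h\<close> other than \<open>e\<close> that leaves
    \<open>U\<close> either starts at \<open>v\<close>, and is then a bridge whose far side already
    lies in \<open>U\<close>, or leaves a far side, and then ends at \<open>v\<close>.\<close>
  show False
  proof (cases "a = v")
    case True
    then have hM: "h \<in> M"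
      using h by (simp add: M_def)
    have Ah: "A h \<subseteq> V" "A h \<noteq> {}" "A h \<noteq> V"
      using A[OF hM] e(4) by blast+
    obtain c d where cd: "c \<in> A h" "d \<in> V" "d \<notin> A h" "link en K c d"
      using cut_connectedD[OF conn Ah] by metis
    then have "en h = {c, d}"
      using crossing[OF hM] unfolding link_def by blast
    then have "b \<in> A h"
      using h(3) True cd A[OF hM] by (auto simp: doubleton_eq_iff)
    then show False
      using ab(3) hM by (auto simp: U_def)
  next
    case False
    then obtain g where g: "g \<in> M" "a \<in> A g"
      using ab(1) by (auto simp: U_def)
    then have "b \<notin> A g"
      using ab(3) by (auto simp: U_def)
    then have "en g = {a, b}"
      using crossing[OF g(1) h(1,3) g(2)] ab(2) by blast
    then have "b = v"
      using g False by (auto simp: M_def)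
    then show False
      using ab(3) by (simp add: U_def)
  qed
qed

locale bipartite_edges =
  fixes X Y :: "'a set" and en :: "'b \<Rightarrow> 'a set" and K :: "'b set" and Y1
  assumes finite: "finite X" "finite Y" "finite K"
    and disj: "X \<inter> Y = {}"
    and en: "e \<in> K \<Longrightarrow> \<exists>x\<in>X. \<exists>y\<in>Y. en e = {x, y}"
    and Y1: "Y1 \<subseteq> Y"
    and surplus: "surplus (link en K) X Y1"
begin

abbreviation "N \<equiv> nbrs (link en K)"

text \<open>Deleting \<open>e\<close> can take only \<open>x\<close> from the neighbourhood in
  \<open>X\<close> of a subset of \<open>Y1\<close>. A set that thereby loses its surplus had
  surplus exactly one and meets \<open>x\<close> through \<open>e\<close> alone.\<close>

lemma essential_edge:
  assumes e: "e \<in> K" "en e = {x, y}" "x \<in> X" "y \<in> Y"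
    and not_surplus: "\<not> surplus (link en (K - {e})) X Y1"
  obtains S where "S \<subseteq> Y1" "y \<in> S" "card (N S \<inter> X) \<le> Suc (card S)"
    "x \<notin> nbrs (link en (K - {e})) S"
proof -
  let ?N' = "nbrs (link en (K - {e}))"
  obtain S where S: "S \<subseteq> Y1" "S \<noteq> {}" "card (?N' S \<inter> X) \<le> card S"
    using not_surplus unfolding surplus_def by (meson not_le)
  have only: "c = x \<and> y \<in> S" if c: "c \<in> N S \<inter> X" "c \<notin> ?N' S" for c
  proof -
    obtain a h where h: "a \<in> S" "h \<in> K" "en h = {a, c}"
      using c by (auto simp: nbrs_def link_def)
    have "h = e"
      using c(2) h by (auto simp: nbrs_def link_def)
    then have "{a, c} = {x, y}"
      using h e by simp
    moreover have "a \<in> Y" "c \<in> X"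
      using h c S Y1 by auto
    ultimately show ?thesis
      using disj e h by (auto simp: doubleton_eq_iff)
  qed
  have big: "card S < card (N S \<inter> X)"
    using surplusD[OF surplus S(1,2)] .
  have fin: "finite (?N' S \<inter> X)"
    using finite by simp
  have "\<not> N S \<inter> X \<subseteq> ?N' S \<inter> X"
    using card_mono[OF fin, of "N S \<inter> X"] big S(3) by (meson leD le_trans)
  then obtain c where "c \<in> N S \<inter> X" "c \<notin> ?N' S"
    by blast
  then have "y \<in> S" "x \<notin> ?N' S"
    using only[of c] by auto
  moreover have "N S \<inter> X \<subseteq> insert x (?N' S \<inter> X)"
    using only by auto
  then have "card (N S \<inter> X) \<le> card (insert x (?N' S \<inter> X))"
    using fin by (intro card_mono) auto
  then have "card (N S \<inter> X) \<le> Suc (card S)"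
    using S(3) card_insert_le_m1[of "Suc (card S)" "?N' S \<inter> X" x] by simp
  ultimately show thesis
    using that S(1) by blast
qed

text \<open>By submodularity the two tight sets from \<open>essential_edge\<close> meet in a tight
  set \<open>S\<close> containing \<open>y\<close>. Both \<open>x1\<close> and \<open>x2\<close> are
  reached from \<open>S\<close> only through \<open>y\<close>, so any further vertex in
  \<open>S\<close> would push its surplus to at least two.\<close>

lemma two_essential_edges:
  assumes e1: "e1 \<in> K" "en e1 = {x1, y}" "x1 \<in> X"
    and e2: "e2 \<in> K" "en e2 = {x2, y}" "x2 \<in> X"
    and y: "y \<in> Y" and ne: "e1 \<noteq> e2"
    and not_surplus: "\<not> surplus (link en (K - {e1})) X Y1" "\<not> surplus (link en (K - {e2})) X Y1"
  shows "y \<in> Y1" "x1 \<noteq> x2" "N {y} \<inter> X = {x1, x2}"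
proof -
  obtain S1 where S1: "S1 \<subseteq> Y1" "y \<in> S1" "card (N S1 \<inter> X) \<le> Suc (card S1)"
    "x1 \<notin> nbrs (link en (K - {e1})) S1"
    using essential_edge[OF e1(1,2,3) y not_surplus(1)] .
  obtain S2 where S2: "S2 \<subseteq> Y1" "y \<in> S2" "card (N S2 \<inter> X) \<le> Suc (card S2)"
    "x2 \<notin> nbrs (link en (K - {e2})) S2"
    using essential_edge[OF e2(1,2,3) y not_surplus(2)] .
  show "y \<in> Y1"
    using S1 by blast
  show x12: "x1 \<noteq> x2"
  proof
    assume "x1 = x2"
    then have "link en (K - {e1}) y x1"
      using e2 ne by (auto simp: link_def insert_commute)
    then show False
      using S1(2,4) by (auto simp: nbrs_def)
  qed
  have unshared: "x \<notin> N (S - {y})"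
    if "x \<notin> nbrs (link en (K - {e})) S" "en e = {x, y}" for x e S
  proof
    assume "x \<in> N (S - {y})"
    then obtain a h where h: "a \<in> S" "a \<noteq> y" "h \<in> K" "en h = {a, x}"
      by (auto simp: nbrs_def link_def)
    then have "h \<noteq> e"
      using that(2) by (auto simp: doubleton_eq_iff)
    then show False
      using h that(1) by (auto simp: nbrs_def link_def)
  qed
  define S where "S = S1 \<inter> S2"
  have finS: "finite S1" "finite S2" "finite S"
    using S1 S2 Y1 finite by (auto simp: S_def intro: finite_subset)
  have S: "y \<in> S" "S \<subseteq> Y1"
    using S1 S2 by (auto simp: S_def)
  have x_in: "{x1, x2} \<subseteq> N {y} \<inter> X"
    using e1 e2 by (auto simp: nbrs_def link_def insert_commute)
  have "card (S1 \<union> S2) < card (N (S1 \<union> S2) \<inter> X)"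
    using S1 S2 by (intro surplusD[OF surplus]) auto
  then have tight: "card (N S \<inter> X) \<le> Suc (card S)"
    using card_nbrs_submodular[OF finite(1), of "link en K" S1 S2] S1(3) S2(3)
      card_Un_Int[OF finS(1,2)] unfolding S_def by linarith
  have "S = {y}"
  proof (rule ccontr)
    assume "S \<noteq> {y}"
    then have "card (S - {y}) < card (N (S - {y}) \<inter> X)"
      using S by (intro surplusD[OF surplus]) auto
    then have "card S \<le> card (N (S - {y}) \<inter> X)"
      using card_Suc_Diff1[OF finS(3) S(1)] by simp
    moreover have "x1 \<notin> N (S - {y})" "x2 \<notin> N (S - {y})"
      using unshared[OF S1(4) e1(2)] unshared[OF S2(4) e2(2)]
        nbrs_mono[of "S - {y}" "S1 - {y}"] nbrs_mono[of "S - {y}" "S2 - {y}"]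
      unfolding S_def by blast+
    then have "card (insert x1 (insert x2 (N (S - {y}) \<inter> X))) = Suc (Suc (card (N (S - {y}) \<inter> X)))"
      using x12 finite by simp
    moreover have "insert x1 (insert x2 (N (S - {y}) \<inter> X)) \<subseteq> N S \<inter> X"
      using x_in nbrs_mono[of "{y}" S "link en K"] nbrs_mono[of "S - {y}" S "link en K"] S by blast
    then have "card (insert x1 (insert x2 (N (S - {y}) \<inter> X))) \<le> card (N S \<inter> X)"
      using finite by (intro card_mono) auto
    ultimately show False
      using tight by linarith
  qed
  then have "card (N {y} \<inter> X) \<le> card {x1, x2}"
    using tight x12 by simp
  then show "N {y} \<inter> X = {x1, x2}"
    using card_seteq[OF _ x_in] finite by simp
qed

text \<open>Otherwise every vertex on a nonbridge meets at least two nonbridges, and exactly two if it is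
  in \<open>Y\<close>; double counting the nonbridges then contradicts the surplus of their ends in Y.\<close>

lemma minimal_imp_bridges:
  assumes conn: "cut_connected (X \<union> Y) (link en K)"
    and minimal: "\<And>e. e \<in> K \<Longrightarrow> cut_connected (X \<union> Y) (link en (K - {e})) \<Longrightarrow>
      \<not> surplus (link en (K - {e})) X Y1"
    and "e \<in> K"
  shows "\<not> cut_connected (X \<union> Y) (link en (K - {e}))"
proof
  define B where "B = {e \<in> K. cut_connected (X \<union> Y) (link en (K - {e}))}"
  define XB where "XB = {x \<in> X. \<exists>e\<in>B. x \<in> en e}"
  define YB where "YB = {y \<in> Y. \<exists>e\<in>B. y \<in> en e}"
  assume "cut_connected (X \<union> Y) (link en (K - {e}))"
  then have "e \<in> B"
    using \<open>e \<in> K\<close> by (simp add: B_def)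
  then have YB_ne: "YB \<noteq> {}"
    using en[of e] \<open>e \<in> K\<close> unfolding YB_def by blast
  have fin: "finite B" "finite XB" "finite YB"
    using finite by (auto simp: B_def XB_def YB_def)
  have B: "\<not> surplus (link en (K - {e})) X Y1" "e \<in> K" if "e \<in> B" for e
    using that minimal by (auto simp: B_def)
  have another: "\<exists>g\<in>B. g \<noteq> e \<and> v \<in> en g" if e: "e \<in> B" "v \<in> en e" for e v
  proof -
    obtain x y where xy: "x \<in> X" "y \<in> Y" "en e = {x, y}" "x \<noteq> y"
      using en[OF B(2)[OF e(1)]] disj by blast
    obtain z where z: "en e = {v, z}" "v \<noteq> z" "v \<in> X \<union> Y" "z \<in> X \<union> Y"
    proof (cases "v = x")
      case True
      then show thesis
        using that[of y] xy by auto
    next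
      case False
      then show thesis
        using that[of x] xy e by auto
    qed
    show ?thesis
      using nonbridge_adjacent[OF conn B(2)[OF e(1)] z] e(1) unfolding B_def by blast
  qed
  have Y_two: "y \<in> Y1 \<and> card {e \<in> B. y \<in> en e} \<le> 2 \<and> N {y} \<inter> X \<subseteq> XB" if y: "y \<in> YB" for y
  proof -
    have yY: "y \<in> Y"
      using y by (simp add: YB_def)
    have form: "\<exists>x\<in>X. en e = {x, y}" if e: "e \<in> B" "y \<in> en e" for e
    proof -
      obtain x y' where "x \<in> X" "y' \<in> Y" "en e = {x, y'}"
        using en[OF B(2)[OF e(1)]] by blast
      moreover from this have "y = y'"
        using e(2) yY disj by auto
      ultimately show ?thesis
        by blast
    qed
    obtain e1 where e1: "e1 \<in> B" "y \<in> en e1"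
      using y by (auto simp: YB_def)
    obtain e2 where e2: "e2 \<in> B" "y \<in> en e2" "e2 \<noteq> e1"
      using another[OF e1] by blast
    obtain x1 x2 where x: "x1 \<in> X" "en e1 = {x1, y}" "x2 \<in> X" "en e2 = {x2, y}"
      using form e1 e2 by metis
    note two = two_essential_edges[OF B(2)[OF e1(1)] x(2,1) B(2)[OF e2(1)] x(4,3) yY
        e2(3)[symmetric] B(1)[OF e1(1)] B(1)[OF e2(1)]]
    \<comment> \<open>Any two nonbridges at \<open>y\<close> have distinct ends in \<open>X\<close>,
      and \<open>y\<close> has only the neighbours \<open>x1\<close> and \<open>x2\<close> there, so
      there is no third.\<close>
    have "{e \<in> B. y \<in> en e} \<subseteq> {e1, e2}"
    proof
      fix e3 assume "e3 \<in> {e \<in> B. y \<in> en e}"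
      then have e3: "e3 \<in> B" "y \<in> en e3"
        by auto
      then obtain x3 where x3: "x3 \<in> X" "en e3 = {x3, y}"
        using form by blast
      have "link en K y x3"
        using x3 B(2)[OF e3(1)] unfolding link_def by (auto simp: insert_commute)
      then have "x3 \<in> {x1, x2}"
        using two(3) x3(1) by (auto simp: nbrs_def)
      moreover have "x3 \<noteq> x1" if "e3 \<noteq> e1"
        using two_essential_edges(2)[OF B(2)[OF e3(1)] x3(2,1) B(2)[OF e1(1)] x(2,1) yY that
            B(1)[OF e3(1)] B(1)[OF e1(1)]] .
      moreover have "x3 \<noteq> x2" if "e3 \<noteq> e2"
        using two_essential_edges(2)[OF B(2)[OF e3(1)] x3(2,1) B(2)[OF e2(1)] x(4,3) yY that
            B(1)[OF e3(1)] B(1)[OF e2(1)]] .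
      ultimately show "e3 \<in> {e1, e2}"
        by blast
    qed
    then have "card {e \<in> B. y \<in> en e} \<le> card {e1, e2}"
      by (intro card_mono) auto
    moreover have "card {e1, e2} \<le> 2"
      by (simp add: card_insert_if)
    moreover have "{x1, x2} \<subseteq> XB"
      using x e1(1) e2(1) unfolding XB_def by blast
    ultimately show ?thesis
      using two by auto
  qed
  have "card {x \<in> XB. x \<in> en e} = 1" "card {y \<in> YB. y \<in> en e} = 1" if e: "e \<in> B" for e
  proof -
    obtain x y where xy: "x \<in> X" "y \<in> Y" "en e = {x, y}"
      using en[OF B(2)[OF e]] by blast
    then have "{x \<in> XB. x \<in> en e} = {x}" "{y \<in> YB. y \<in> en e} = {y}"
      using disj e by (auto simp: XB_def YB_def)
    then show "card {x \<in> XB. x \<in> en e} = 1" "card {y \<in> YB. y \<in> en e} = 1"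
      by simp_all
  qed
  then have count: "(\<Sum>x\<in>XB. card {e \<in> B. x \<in> en e}) = card B"
    "(\<Sum>y\<in>YB. card {e \<in> B. y \<in> en e}) = card B"
    using sum_multicount[OF fin(2,1), of "\<lambda>x e. x \<in> en e" 1]
      sum_multicount[OF fin(3,1), of "\<lambda>y e. y \<in> en e" 1] by simp_all
  have "2 \<le> card {e \<in> B. x \<in> en e}" if x: "x \<in> XB" for x
  proof -
    obtain e where e: "e \<in> B" "x \<in> en e"
      using x by (auto simp: XB_def)
    then obtain g where g: "g \<in> B" "g \<noteq> e" "x \<in> en g"
      using another by blast
    have "card {e, g} \<le> card {e \<in> B. x \<in> en e}"
      using e g fin by (intro card_mono) auto
    then show ?thesis
      using g by simp
  qed
  \<comment> \<open>Hence \<open>2 * card XB \<le> card B \<le> 2 * card YB\<close>, whereas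
    \<open>XB\<close> contains all neighbours of \<open>YB\<close> in \<open>X\<close> and is
    therefore the larger by surplus.\<close>
  then have "(\<Sum>x\<in>XB. 2) \<le> card B"
    unfolding count(1)[symmetric] by (intro sum_mono) auto
  moreover have "card B \<le> (\<Sum>y\<in>YB. 2)"
    unfolding count(2)[symmetric] using Y_two by (intro sum_mono) auto
  ultimately have "card XB \<le> card YB"
    by simp
  moreover have "card YB < card (N YB \<inter> X)"
    using Y_two YB_ne by (intro surplusD[OF surplus]) auto
  moreover have "N YB \<inter> X \<subseteq> XB"
    using Y_two unfolding nbrs_def by blast
  then have "card (N YB \<inter> X) \<le> card XB"
    using fin by (intro card_mono)
  ultimately show False
    by linarith
qed

end

section \<open>Walks, cycles and cuts\<close>

text \<open>Discrete intermediate value principle, which finds the step at which a walk leaves a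
  set.\<close>

lemma exists_crossing_index:
  fixes i j :: nat
  assumes "i \<le> j" "P i" "\<not> P j"
  shows "\<exists>k. i \<le> k \<and> k < j \<and> P k \<and> \<not> P (Suc k)"
  using assms by (induction rule: dec_induct) (auto intro: less_SucI)

lemma walk_hd_last:
  assumes "walk G vs es"
  shows "hd vs = vs ! 0" "last vs = vs ! length es"
proof -
  have "length vs = Suc (length es)"
    using assms by (simp add: walk_def)
  moreover from this have "vs \<noteq> []"
    by auto
  ultimately show "hd vs = vs ! 0" "last vs = vs ! length es"
    by (simp_all add: hd_conv_nth last_conv_nth)
qed

lemma walk_nth:
  assumes "walk G vs es" "k < length es"
  shows "vs ! k \<in> verts G" "vs ! Suc k \<in> verts G" "es ! k \<in> edges G"
    "ends G (es ! k) = {vs ! k, vs ! Suc k}"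
proof -
  have "vs ! k \<in> set vs" "vs ! Suc k \<in> set vs" "es ! k \<in> set es"
    using assms by (simp_all add: walk_def)
  then show "vs ! k \<in> verts G" "vs ! Suc k \<in> verts G" "es ! k \<in> edges G"
    using assms(1) unfolding walk_def by blast+
  show "ends G (es ! k) = {vs ! k, vs ! Suc k}"
    using assms by (simp add: walk_def)
qed

lemma graph_connected_imp_cut_connected:
  assumes "graph_connected G"
  shows "cut_connected (verts G) (link (ends G) (edges G))"
  unfolding cut_connected_def
proof (intro allI impI)
  fix A assume A: "A \<subseteq> verts G" "A \<noteq> {}" "A \<noteq> verts G"
  then obtain u v where uv: "u \<in> A" "v \<in> verts G" "v \<notin> A" "u \<in> verts G"
    by blast
  then obtain vs es where w: "walk G vs es" "hd vs = u" "last vs = v"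
    using assms unfolding graph_connected_def by metis
  have "vs ! 0 = u" "vs ! length es = v"
    using w walk_hd_last[OF w(1)] by simp_all
  then obtain k where k: "k < length es" "vs ! k \<in> A" "vs ! Suc k \<notin> A"
    using exists_crossing_index[of 0 "length es" "\<lambda>i. vs ! i \<in> A"] uv by auto
  then show "\<exists>a\<in>A. \<exists>b\<in>verts G - A. link (ends G) (edges G) a b"
    using walk_nth[OF w(1) k(1)] unfolding link_def by blast
qed

lemma walk_snoc:
  assumes "walk G vs es" "last vs = a" "e \<in> edges G" "ends G e = {a, b}" "b \<in> verts G"
  shows "walk G (vs @ [b]) (es @ [e])"
proof -
  have len: "length vs = Suc (length es)"
    using assms by (simp add: walk_def)
  have "vs ! length es = a"
    using assms(2) walk_hd_last[OF assms(1)] by simp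
  then show ?thesis
    using assms len by (auto simp: walk_def nth_append less_Suc_eq)
qed

lemma cut_connected_imp_graph_connected:
  assumes conn: "cut_connected (verts G) (link (ends G) (edges G))" and "verts G \<noteq> {}"
  shows "graph_connected G"
  unfolding graph_connected_def
proof (intro conjI ballI)
  fix u v assume u: "u \<in> verts G" and v: "v \<in> verts G"
  define A where "A = {v \<in> verts G. \<exists>vs es. walk G vs es \<and> hd vs = u \<and> last vs = v}"
  have "walk G [u] []"
    using u by (simp add: walk_def)
  then have uA: "u \<in> A"
    using u by (force simp: A_def)
  have "A = verts G"
  proof (rule ccontr)
    assume "A \<noteq> verts G"
    moreover have "A \<subseteq> verts G" "A \<noteq> {}"
      using uA by (auto simp: A_def)
    ultimately obtain a b where ab: "a \<in> A" "b \<in> verts G" "b \<notin> A" "link (ends G) (edges G) a b"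
      using cut_connectedD[OF conn] by metis
    then obtain vs es e where w: "walk G vs es" "hd vs = u" "last vs = a"
      and e: "e \<in> edges G" "ends G e = {a, b}"
      unfolding A_def link_def by blast
    have "walk G (vs @ [b]) (es @ [e])"
      using walk_snoc[OF w(1,3) e ab(2)] .
    moreover have "vs \<noteq> []"
      using w(1) by (auto simp: walk_def)
    then have "hd (vs @ [b]) = u" "last (vs @ [b]) = b"
      using w by simp_all
    ultimately have "b \<in> A"
      using ab(2) unfolding A_def by blast
    then show False
      using ab by blast
  qed
  then show "\<exists>vs es. walk G vs es \<and> hd vs = u \<and> last vs = v"
    using v by (auto simp: A_def)
qed fact

text \<open>The cycle is closed, so a cut crossed by its first edge is crossed again later;
  distinctness of the edges makes that later edge survive the deletion.\<close>

lemma cycle_edge_nonbridge: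
  assumes conn: "cut_connected (verts G) (link (ends G) (edges G))" and cycle: "is_cycle G vs es"
  shows "cut_connected (verts G) (link (ends G) (edges G - {es ! 0}))"
  unfolding cut_connected_def
proof (intro allI impI)
  have w: "walk G vs es" "es \<noteq> []" "hd vs = last vs" "distinct es"
    using cycle by (auto simp: is_cycle_def)
  have closed: "vs ! length es = vs ! 0"
    using w(3) walk_hd_last[OF w(1)] by simp
  note edge = walk_nth[OF w(1)]
  fix A assume A: "A \<subseteq> verts G" "A \<noteq> {}" "A \<noteq> verts G"
  then obtain a b where ab: "a \<in> A" "b \<in> verts G" "b \<notin> A" "link (ends G) (edges G) a b"
    using cut_connectedD[OF conn] by metis
  then obtain h where h: "h \<in> edges G" "ends G h = {a, b}"
    by (auto simp: link_def)
  show "\<exists>a\<in>A. \<exists>b\<in>verts G - A. link (ends G) (edges G - {es ! 0}) a b"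
  proof (cases "h = es ! 0")
    case False
    then show ?thesis
      using ab h unfolding link_def by blast
  next
    case True
    then have "{a, b} = {vs ! 0, vs ! 1}"
      using h edge[of 0] w(2) by simp
    then have "vs ! 0 \<in> A \<longleftrightarrow> vs ! 1 \<notin> A"
      using ab by (auto simp: doubleton_eq_iff)
    moreover have "1 \<le> length es"
      using w(2) by (simp add: Suc_le_eq)
    \<comment> \<open>Starting at index 1 skips the deleted edge, and comparing with
      \<open>vs ! 1\<close> covers crossings in both directions.\<close>
    ultimately obtain k where k: "1 \<le> k" "k < length es" "vs ! k \<in> A \<longleftrightarrow> vs ! Suc k \<notin> A"
      using exists_crossing_index[of 1 "length es" "\<lambda>i. vs ! i \<in> A \<longleftrightarrow> vs ! 1 \<in> A"] closed by auto
    have "es ! k \<noteq> es ! 0"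
      using w(2,4) k nth_eq_iff_index_eq[of es k 0] by auto
    then have "link (ends G) (edges G - {es ! 0}) (vs ! k) (vs ! Suc k)"
      using edge[OF k(2)] by (auto simp: link_def)
    then show ?thesis
      using k(3) edge[OF k(2)] link_sym by (metis Diff_iff)
  qed
qed

section \<open>Extraction of the tree\<close>

text \<open>Breaking cycles arbitrarily could destroy surplus. Instead a smallest edge set keeping
  both connectivity and surplus is taken, and \<open>minimal_imp_bridges\<close> makes all its edges
  bridges.\<close>

lemma (in finite_loopless_multigraph) bipartite_spanning_tree:
  assumes XY: "X \<union> Y = verts G" "X \<inter> Y = {}" "verts G \<noteq> {}" and "Y1 \<subseteq> Y"
    and conn: "cut_connected (verts G) (cross X Y (link (ends G) (edges G)))"
    and surp: "surplus (link (ends G) (edges G)) X Y1"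
  obtains T where "spanning_tree T G" "bipartition T (X, Y)" "leaves T \<inter> Y1 = {}"
proof -
  let ?V = "verts G" and ?en = "ends G"
  define P where "P K \<longleftrightarrow> K \<subseteq> edges G \<and> (\<forall>e\<in>K. \<exists>x\<in>X. \<exists>y\<in>Y. ?en e = {x, y}) \<and>
    cut_connected ?V (link ?en K) \<and> surplus (link ?en K) X Y1" for K
  define K0 where "K0 = {e \<in> edges G. \<exists>x\<in>X. \<exists>y\<in>Y. ?en e = {x, y}}"
  have link0: "link ?en K0 a b" if "cross X Y (link ?en (edges G)) a b" for a b
    using that by (auto simp: cross_def link_def K0_def)
  \<comment> \<open>Restricting to edges between \<open>X\<close> and \<open>Y\<close> costs a
    subset of \<open>Y\<close> none of its neighbours in \<open>X\<close>.\<close>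
  have "nbrs (link ?en (edges G)) S \<inter> X \<subseteq> nbrs (link ?en K0) S \<inter> X" if "S \<subseteq> Y1" for S
    using link0 that assms(4) unfolding nbrs_def cross_def by blast
  then have "card (nbrs (link ?en (edges G)) S \<inter> X) \<le> card (nbrs (link ?en K0) S \<inter> X)"
    if "S \<subseteq> Y1" for S
    using that XY(1) finite_verts by (intro card_mono) (auto intro: finite_subset)
  then have "surplus (link ?en K0) X Y1"
    using surp unfolding surplus_def by (meson less_le_trans)
  moreover have "cut_connected ?V (link ?en K0)"
    using conn by (rule cut_connected_mono) (rule link0)
  ultimately have "P K0"
    by (auto simp: P_def K0_def)
  then obtain K where K: "P K" and least: "\<And>K'. P K' \<Longrightarrow> card K \<le> card K'"
    using ex_has_least_nat[of P _ card] by blast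
  have finK: "finite K"
    using K finite_edges by (auto simp: P_def intro: finite_subset)
  interpret bipartite_edges X Y ?en K Y1
    using K XY finite_verts finK assms(4)
    by unfold_locales (auto simp: P_def intro: finite_subset)
  have bridge: "\<not> cut_connected ?V (link ?en (K - {e}))" if e: "e \<in> K" for e
  proof -
    have "\<not> surplus (link ?en (K - {e})) X Y1"
      if "e \<in> K" "cut_connected ?V (link ?en (K - {e}))" for e
    proof
      assume "surplus (link ?en (K - {e})) X Y1"
      then have "P (K - {e})"
        using K that by (auto simp: P_def)
      then show False
        using least[of "K - {e}"] card_Diff1_less[OF finK that(1)] by simp
    qed
    then show ?thesis
      using minimal_imp_bridges[OF _ _ e] K XY(1) by (simp add: P_def)
  qed
  define T :: "('a, 'b) multigraph" where "T = \<lparr>verts = ?V, edges = K, ends = ?en\<rparr>"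
  have T: "verts T = ?V" "edges T = K" "ends T = ?en"
    by (simp_all add: T_def)
  have KG: "K \<subseteq> edges G" and connK: "cut_connected ?V (link ?en K)"
    using K by (auto simp: P_def)
  have "finite_loopless_multigraph T"
    using KG finK finite_verts ends_in_verts two_ends by unfold_locales (auto simp: T)
  moreover have "graph_connected T"
    using cut_connected_imp_graph_connected[of T] connK XY(3) by (simp add: T)
  moreover have "\<not> is_cycle T vs es" for vs es
  proof
    assume cyc: "is_cycle T vs es"
    then have "es ! 0 \<in> K"
      unfolding is_cycle_def walk_def T by (metis length_greater_0_conv nth_mem subsetD)
    then show False
      using cycle_edge_nonbridge[of T, OF _ cyc] connK bridge by (simp add: T)
  qed
  ultimately have "spanning_tree T G"
    using KG by (simp add: spanning_tree_def is_tree_def subgraph_def T)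
  moreover have "bipartition T (X, Y)"
    using XY K by (simp add: bipartition_def T P_def)
  moreover have "y \<notin> leaves T" if y: "y \<in> Y1" for y
  proof
    assume "y \<in> leaves T"
    then obtain e where e: "{e \<in> K. y \<in> ?en e} = {e}"
      by (auto simp: leaves_def vdegree_def T card_1_singleton_iff)
    then have "e \<in> K" "y \<in> ?en e"
      by blast+
    moreover from this obtain x' y' where "?en e = {x', y'}"
      using en by blast
    ultimately obtain z where z: "?en e = {y, z}"
      by auto
    \<comment> \<open>A leaf has a single neighbour, while the surplus of \<open>{y}\<close> demands
      two.\<close>
    have "N {y} \<inter> X \<subseteq> {z}"
    proof
      fix x assume "x \<in> N {y} \<inter> X"
      then obtain h where h: "h \<in> K" "?en h = {y, x}"
        by (auto simp: nbrs_def link_def)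
      then have "h = e"
        using e by blast
      then show "x \<in> {z}"
        using h z by (auto simp: doubleton_eq_iff)
    qed
    then have "card (N {y} \<inter> X) \<le> card {z}"
      by (intro card_mono) auto
    moreover have "card {y} < card (N {y} \<inter> X)"
      using y by (intro surplusD[OF surplus]) auto
    ultimately show False
      by simp
  qed
  ultimately show thesis
    using that by blast
qed

section \<open>Surplus of independent sets of maximum degree\<close>

text \<open>Each vertex of \<open>S\<close> lies on \<open>max_degree G\<close> of the edges meeting
  \<open>S\<close>, each neighbour on at most as many. If the neighbours do not outnumber
  \<open>S\<close>, equality holds throughout, edges at neighbours all lead back to
  \<open>S\<close>, and connectedness makes \<open>G\<close> regular bipartite.\<close>

lemma (in finite_loopless_multigraph) max_degree_surplus_graph:
  assumes conn: "graph_connected G" and not_reg: "\<not> (regular_graph G \<and> bipartite G)"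
  shows "surplus_graph (verts G) (link (ends G) (edges G))
    {v \<in> verts G. vdegree G v = max_degree G}"
proof
  let ?V = "verts G" and ?E = "link (ends G) (edges G)" and ?m = "max_degree G"
  show "finite ?V"
    by (rule finite_verts)
  show "a \<in> ?V" if "?E a b" for a b
    using that ends_in_verts by (auto simp: link_def)
  show "?E b a" if "?E a b" for a b
    using that by (rule link_sym)
  show "\<not> ?E a a" for a
    using two_ends by (force simp: link_def)
  show cut: "cut_connected ?V ?E"
    using conn by (rule graph_connected_imp_cut_connected)
  fix S assume S: "S \<subseteq> {v \<in> ?V. vdegree G v = ?m}" "S \<subseteq> ?V" "S \<noteq> {}"
    and indep: "\<And>a b. a \<in> S \<Longrightarrow> b \<in> S \<Longrightarrow> \<not> ?E a b"
  show "card S < card (nbrs ?E S)"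
  proof (rule ccontr)
    let ?N = "nbrs ?E S"
    assume "\<not> card S < card ?N"
    then have le: "card ?N \<le> card S"
      by simp
    have "n \<in> ?V" if "?E s n" for s n
      using that ends_in_verts by (force simp: link_def)
    then have N: "?N \<subseteq> ?V" "?N \<inter> S = {}"
      using indep unfolding nbrs_def by blast+
    define ES where "ES = {e \<in> edges G. \<exists>s\<in>S. s \<in> ends G e}"
    have fin: "finite S" "finite ?N" "finite ES"
      using finite_subset[OF S(2)] finite_subset[OF N(1)] finite_verts finite_edges
      by (simp_all add: ES_def)
    have form: "\<exists>s\<in>S. \<exists>n\<in>?N. ends G e = {s, n}" if e: "e \<in> ES" for e
    proof -
      obtain s where s: "s \<in> S" "s \<in> ends G e" "e \<in> edges G"
        using e by (auto simp: ES_def)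
      then obtain n where "ends G e = {s, n}"
        using two_ends[of e] unfolding card_2_iff by (metis insert_commute insertE singletonD)
      moreover from this have "n \<in> ?N"
        using s by (auto simp: nbrs_def link_def)
      ultimately show ?thesis
        using s by blast
    qed
    have "card {s \<in> S. s \<in> ends G e} = 1" "card {n \<in> ?N. n \<in> ends G e} = 1" if e: "e \<in> ES" for e
    proof -
      obtain s n where "s \<in> S" "n \<in> ?N" "ends G e = {s, n}"
        using form[OF e] by blast
      then have "{s \<in> S. s \<in> ends G e} = {s}" "{n \<in> ?N. n \<in> ends G e} = {n}"
        using N(2) by auto
      then show "card {s \<in> S. s \<in> ends G e} = 1" "card {n \<in> ?N. n \<in> ends G e} = 1"
        by simp_all
    qed
    then have count: "(\<Sum>s\<in>S. card {e \<in> ES. s \<in> ends G e}) = card ES"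
      "(\<Sum>n\<in>?N. card {e \<in> ES. n \<in> ends G e}) = card ES"
      using sum_multicount[OF fin(1,3), of "\<lambda>s e. s \<in> ends G e" 1]
        sum_multicount[OF fin(2,3), of "\<lambda>n e. n \<in> ends G e" 1] by simp_all
    have deg_S: "card {e \<in> ES. s \<in> ends G e} = ?m" if "s \<in> S" for s
    proof -
      have "{e \<in> ES. s \<in> ends G e} = {e \<in> edges G. s \<in> ends G e}"
        using that by (auto simp: ES_def)
      then show ?thesis
        using that S(1) by (auto simp: vdegree_def)
    qed
    have deg_le: "vdegree G v \<le> ?m" if "v \<in> ?V" for v
      using that finite_verts unfolding max_degree_def by (intro Max_ge) auto
    have deg_N: "card {e \<in> ES. n \<in> ends G e} \<le> vdegree G n" for n
      unfolding vdegree_def using finite_edges by (intro card_mono) (auto simp: ES_def)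
    have upper: "card {e \<in> ES. n \<in> ends G e} \<le> ?m" if "n \<in> ?N" for n
      using deg_N[of n] deg_le[of n] N(1) that by force
    have "(\<Sum>n\<in>?N. ?m) \<le> (\<Sum>n\<in>?N. card {e \<in> ES. n \<in> ends G e})"
      using count deg_S mult_le_mono1[OF le, of ?m] by simp
    then have eq: "(\<Sum>n\<in>?N. card {e \<in> ES. n \<in> ends G e}) = (\<Sum>n\<in>?N. ?m)"
      using sum_mono[OF upper] by (intro antisym)
    have full: "card {e \<in> ES. n \<in> ends G e} = ?m" if "n \<in> ?N" for n
      using sum_mono_inv[OF eq upper that fin(2)] .
    \<comment> \<open>A neighbour reaches maximum degree with its edges to \<open>S\<close> alone,
      so it has no others.\<close>
    have N_edges: "e \<in> ES" if e: "e \<in> edges G" "n \<in> ends G e" "n \<in> ?N" for e n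
    proof -
      have "{e \<in> ES. n \<in> ends G e} = {e \<in> edges G. n \<in> ends G e}"
      proof (rule card_seteq)
        show "card {e \<in> edges G. n \<in> ends G e} \<le> card {e \<in> ES. n \<in> ends G e}"
          using full[OF e(3)] deg_le[of n] N(1) e(3) by (auto simp: vdegree_def)
      qed (use finite_edges in \<open>auto simp: ES_def\<close>)
      then show ?thesis
        using e by blast
    qed
    have V: "S \<union> ?N = ?V"
    proof (rule ccontr)
      assume "S \<union> ?N \<noteq> ?V"
      moreover have "S \<union> ?N \<subseteq> ?V" "S \<union> ?N \<noteq> {}"
        using S N by auto
      ultimately obtain a b where ab: "a \<in> S \<union> ?N" "b \<notin> S \<union> ?N" "?E a b"
        using cut_connectedD[OF cut] by metis
      then obtain e where e: "e \<in> edges G" "ends G e = {a, b}"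
        by (auto simp: link_def)
      then have "e \<in> ES"
        using ab(1) N_edges[of e a] by (auto simp: ES_def)
      then obtain s n where "s \<in> S" "n \<in> ?N" "ends G e = {s, n}"
        using form by blast
      then show False
        using e(2) ab(2) by (auto simp: doubleton_eq_iff)
    qed
    have "vdegree G v = ?m" if "v \<in> ?V" for v
    proof (cases "v \<in> S")
      case False
      then have "v \<in> ?N"
        using that V by blast
      then show ?thesis
        using full deg_N[of v] deg_le[OF that] by simp
    qed (use S in auto)
    then have "regular_graph G"
      by (auto simp: regular_graph_def)
    moreover have "e \<in> ES" if e: "e \<in> edges G" for e
    proof -
      obtain v where "v \<in> ends G e"
        using two_ends[OF e] by fastforce
      then show ?thesis
        using V ends_in_verts[OF e] N_edges[OF e] e by (auto simp: ES_def)
    qed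
    then have "bipartition G (S, ?N)"
      using V N(2) form unfolding bipartition_def by blast
    then have "bipartite G"
      by (auto simp: bipartite_def)
    ultimately show False
      using not_reg by blast
  qed
qed

section \<open>Weakly even trees with a prescribed type\<close>

lemma (in finite_loopless_multigraph) weakly_even_spanning_tree:
  assumes conn: "graph_connected G" and not_reg: "\<not> (regular_graph G \<and> bipartite G)"
    and w: "w \<in> verts G" and l: "l \<in> {0, 1}"
  shows "\<exists>T P. spanning_tree T G \<and> wl_tree T P w l \<and> weakly_even G T P"
proof -
  let ?E = "link (ends G) (edges G)" and ?D = "{v \<in> verts G. vdegree G v = max_degree G}"
  interpret surplus_graph "verts G" ?E ?D
    using max_degree_surplus_graph[OF conn not_reg] .
  \<comment> \<open>Without loops a one-vertex graph has no edges and is regular bipartite.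
    Excluding it gives \<open>w\<close> a neighbour.\<close>
  have "verts G \<noteq> {w}"
  proof
    assume single: "verts G = {w}"
    have "e \<notin> edges G" for e
    proof
      assume e: "e \<in> edges G"
      have "card (ends G e) \<le> card {w}"
        using ends_in_verts[OF e] single by (intro card_mono) auto
      then show False
        using two_ends[OF e] by simp
    qed
    then have "bipartition G ({w}, {})"
      using single by (auto simp: bipartition_def)
    moreover have "regular_graph G"
      using single by (auto simp: regular_graph_def)
    ultimately show False
      using not_reg unfolding bipartite_def by blast
  qed
  then obtain w' where "?E w w'"
    using cut_connectedD[OF connected, of "{w}"] w by auto
  \<comment> \<open>\<open>x\<close> will get type 0 and \<open>y\<close> type 1, so
    \<open>w\<close> is made the end of an incident edge that carries its type
    \<open>l\<close>.\<close>
  then have "\<exists>y x. ?E y x \<and> w = (if l = 0 then x else y)"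
    using sym by metis
  then obtain y x where yx: "?E y x" "w = (if l = 0 then x else y)"
    by blast
  obtain X Y where XY: "good X Y" "X \<union> Y = verts G" "y \<in> Y" "x \<in> X"
    using spanning_good_exists[OF surplus_graph_axioms yx(1)] by blast
  then have g: "X \<inter> Y = {}" "cut_connected (verts G) (cross X Y ?E)" "surplus ?E X (Y \<inter> ?D)"
    by (auto simp: good_def)
  obtain T where T: "spanning_tree T G" "bipartition T (X, Y)" "leaves T \<inter> (Y \<inter> ?D) = {}"
    using bipartite_spanning_tree[OF XY(2) g(1) _ _ g(2,3)] w by blast
  have "w \<in> part (X, Y) l"
    using yx(2) XY by (simp add: part_def)
  then have "wl_tree T (X, Y) w l"
    using T by (simp add: wl_tree_def wl_bipartition_def spanning_tree_def)
  moreover have "leaves T \<subseteq> X \<union> Y"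
    using T(1) XY(2) by (auto simp: leaves_def spanning_tree_def)
  then have "weakly_even G T (X, Y)"
    using T(3) XY(2) unfolding weakly_even_def part_def by auto
  ultimately show ?thesis
    using T(1) by blast
qed

theorem theorem1p5:
  fixes G :: "('a, 'b) multigraph"
  assumes "finite_loopless_multigraph G" and "graph_connected G"
  shows
    "(\<not> (regular_graph G \<and> bipartite G) \<longrightarrow>
        (\<forall>w \<in> verts G. \<forall>l \<in> {0, 1}.
           \<exists>T P. spanning_tree T G \<and> wl_tree T P w l \<and> weakly_even G T P)) \<and>
     (\<not> (regular_graph G \<and> bipartite G) \<longrightarrow>
        (\<exists>T P. spanning_tree T G \<and> bipartition T P \<and>
           (\<exists>l \<in> {0, 1}. {v \<in> leaves T. vdegree G v = max_degree G} \<subseteq> part P l))) \<and>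
     (regular_graph G \<and> \<not> bipartite G \<longrightarrow>
        (\<exists>T P. spanning_tree T G \<and> bipartition T P \<and>
           (\<exists>l \<in> {0, 1}. leaves T \<subseteq> part P l)))"
proof -
  interpret finite_loopless_multigraph G
    by fact
  obtain w where w: "w \<in> verts G"
    using assms(2) by (auto simp: graph_connected_def)
  have one_part: "\<exists>T P. spanning_tree T G \<and> bipartition T P \<and>
      (\<exists>l \<in> {0, 1}. {v \<in> leaves T. vdegree G v = max_degree G} \<subseteq> part P l)"
    if not_reg: "\<not> (regular_graph G \<and> bipartite G)"
  proof -
    obtain T P where "spanning_tree T G" "wl_tree T P w 0" "weakly_even G T P"
      using weakly_even_spanning_tree[OF assms(2) not_reg w, of 0] by blast
    moreover from this have "{v \<in> leaves T. vdegree G v = max_degree G} \<subseteq> part P 0"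
      by (auto simp: weakly_even_def)
    ultimately show ?thesis
      unfolding wl_tree_def wl_bipartition_def by blast
  qed
  moreover have "\<exists>T P. spanning_tree T G \<and> bipartition T P \<and> (\<exists>l \<in> {0, 1}. leaves T \<subseteq> part P l)"
    if reg: "regular_graph G \<and> \<not> bipartite G"
  proof -
    obtain k where k: "\<forall>v \<in> verts G. vdegree G v = k"
      using reg by (auto simp: regular_graph_def)
    \<comment> \<open>In a regular graph every vertex has maximum degree, so the previous claim
      speaks of all leaves.\<close>
    then have "vdegree G ` verts G = {k}"
      using w by auto
    then have "max_degree G = k"
      by (simp add: max_degree_def)
    then have "{v \<in> leaves T. vdegree G v = max_degree G} = leaves T" if "spanning_tree T G" for T
      using that k by (auto simp: leaves_def spanning_tree_def)
    then show ?thesis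
      using one_part reg by metis
  qed
  ultimately show ?thesis
    using weakly_even_spanning_tree[OF assms(2)] by blast
qed

end
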